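(* Let $\Xi$ be an associative strict clan and $q\in\mathbb R$. Let $\tau=(\{\mathbf H_a\mid a\in A\},\mathbf H)\in\Xi$, $a_0\in A$, and $\tau'=(\{\mathbf H_{(a_0,a')}\mid a'\in A'\},\mathbf H_{a_0})\in\Xi$; let $A''=(A\setminus\{a_0\})\cup\{(a_0,a')\mid a'\in A'\}$ and let $\tau''=(\{\mathbf H_{a''}\mid a''\in A''\},\mathbf H)$ be the grafting of $\tau'$ to $\tau$ along $a_0$. Let constructs $C_a$ of $\mathbf H_a$ ($a\in A\setminus\{a_0\}$) and $C_{(a_0,a')}$ of $\mathbf H_{(a_0,a')}$ ($a'\in A'$) be given, and set $\delta''=(\{C_{a''}\mid a''\in A''\},\mathbf H)$ (support $\tau''$) and $\delta'=(\{C_{(a_0,a')}\mid a'\in A'\},\mathbf H_{a_0})$ (support $\tau'$). For a linear construct $\mathbf D$ of $\mathbf H_{a_0}$ write $\delta[\mathbf D]$ for the linear delegation of support $\tau$ with $C_a$ at each $a\in A\setminus\{a_0\}$ and $\mathbf D$ at $a_0$. Then for every $\emptyset\neq B''\subseteq A''$ the polydendriform equation holds: $$\ast^{\tau''}_{B''}(\delta'')=\begin{cases}\ast^{\tau}_{B''}\big(\delta[\ast^{\tau'}(\delta')]\big)&\text{if }B''\subseteq A\setminus\{a_0\},\\ \ast^{\tau}_{B}\big(\delta[\ast^{\tau'}_{B'}(\delta')]\big)&\text{if }B''\not\subseteq A\setminus\{a_0\},\end{cases}$$ where in the second case $B=(B''\cap(A\setminus\{a_0\}))\cup\{a_0\}$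 and $B'=\{a'\in A'\mid (a_0,a')\in B''\}$ (both nonempty). Moreover, $\ast^{\tau''}(\delta'')=\ast^{\tau}\big(\delta[\ast^{\tau'}(\delta')]\big)$.
   Context: Hypergraphs. A (finite) hypergraph $\mathbf H$ on a finite carrier $H$ is a set $\mathbf H\subseteq\mathcal P(H)\setminus\{\emptyset\}$ with $\bigcup\mathbf H=H$ and $\{x\}\in\mathbf H$ for all $x\in H$. For $X\subseteq H$, $\mathbf H_X=\{Z\in\mathbf H:Z\subseteq X\}$, $\mathbf H\setminus X=\mathbf H_{H\setminus X}$. $\mathbf H$ is connected if there is no partition $H=X_1\sqcup X_2$ into nonempty sets with $\mathbf H=\mathbf H_{X_1}\cup\mathbf H_{X_2}$. Every finite hypergraph is uniquely $\bigcup_i\mathbf H_{X_i}$ for a partition $H=\bigsqcup X_i$ with each $\mathbf H_{X_i}$ connected (its connected components); $\mathbf H,X\leadsto\mathbf H_1,\dots,\mathbf H_n$ means that these are the connected components of $\mathbf H\setminus X$. Constructs. Constructs of $\mathbf H$ are non-planar rooted trees with nodes labelled by nonempty subsets of $H$, defined recursively: if $\emptyset\neq Y\subseteq H$, $\mathbf H,Y\leadsto\mathbf H_1,\dots,\mathbf H_n$ and $T_i$ is a construct of $\mathbf H_i$, then $Y(T_1,\dots,T_n)$ (root $Y$, subtrees $T_i$) is a construct of $\mathbf H$, with $\mathrm{root}=Y$ (if $Y=H$, $n=0$). A linear construct of $\mathbf H$ is a real linear combination of constructs of $\mathbf H$; $Y(\mathbf C_1,\dots,\mathbf C_n)$ is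 extended multilinearly. Teams and clans. Fix a universe $\mathfrak U$ (a collection of finite connected hypergraphs). A preteam is $\tau=(\{\mathbf H_a\mid a\in A\},\mathbf H)$ with $A$ finite, all $\mathbf H_a,\mathbf H\in\mathfrak U$, $H=\bigsqcup_a H_a$. For $\emptyset\ne B\subseteq A$ and nonempty $X_b\subseteq H_b$ ($b\in B$), write $\mathbf H_b,X_b\leadsto\mathbf H_{(b,1)},\dots,\mathbf H_{(b,n_b)}$, $\mathbf H,\bigcup_{b\in B}X_b\leadsto\mathbf H^B_1,\dots,\mathbf H^B_{n_B}$, $\tilde A=(A\setminus B)\cup\{(b,i)\mid b\in B,1\le i\le n_b\}$. $\tau$ is a strict team if for all such choices and all $\tilde a\in\tilde A$, $\mathbf H_{\tilde a}\in\mathfrak U$ and $H_{\tilde a}$ lies in a connected component of $\mathbf H\setminus\bigcup_bX_b$; $\varphi^B_\tau(\tilde a)$ is the index $i$ with $H_{\tilde a}\subseteq H^B_i$, and $\tau_i=(\{\mathbf H_{\tilde a}\mid\varphi^B_\tau(\tilde a)=i\},\mathbf H^B_i)$. A strict clan is a set $\Xi$ of strict teams such that all such $\tau_i$ lie in $\Xi$ whenever $\tau\in\Xi$. It is associative if whenever $\tau=(\{\mathbf H_a\mid a\in A\},\mathbf H)\in\Xi$, $a_0\in A$, $\tau'=(\{\mathbf H_{(a_0,a')}\mid a'\in A'\},\mathbf H_{a_0})\in\Xi$, the grafting $(\{\mathbf H_a\mid a\in A\setminus\{a_0\}\}\cup\{\mathbf H_{(a_0,a')}\mid a'\in A'\},\mathbf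 H)$ is in $\Xi$. Shuffle product. Fix $q\in\mathbb R$. A delegation is $\delta=(\{C_a\mid a\in A\},\mathbf H)$ with $C_a$ a construct of $\mathbf H_a$ and support $\tau=(\{\mathbf H_a\},\mathbf H)\in\Xi$. With $X_a=\mathrm{root}(C_a)$ and $\emptyset\ne B\subseteq A$, write $C_b=X_b(C_{(b,1)},\dots,C_{(b,n_b)})$, $C_{(b,i)}$ a construct of $\mathbf H_{(b,i)}$, so a construct $C_{\tilde a}$ is given for every $\tilde a\in\tilde A$, and set $\delta^B_i=(\{C_{\tilde a}\mid\varphi^B_\tau(\tilde a)=i\},\mathbf H^B_i)$. Recursively, $\ast(\delta)=\sum_{\emptyset\ne B\subseteq A}q^{|B|-1}\ast_B(\delta)$ and $\ast_B(\delta)=(\bigcup_{b\in B}X_b)(\ast(\delta^B_1),\dots,\ast(\delta^B_{n_B}))$, a linear construct of $\mathbf H$. Superscripts $\ast^\tau,\ast^\tau_B$ record the support. Both are extended multilinearly to linear delegations (families of linear constructs of the $\mathbf H_a$ with support in $\Xi$). *)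

theory Defs
  imports Complex_Main "HOL-Library.FSet" "HOL-Library.Poly_Mapping" "HOL-Library.Disjoint_Sets"
    "HOL-Library.FuncSet"
begin

section \<open>Hypergraphs\<close>

text \<open>A hypergraph is its set of hyperedges; its carrier is the union \<open>\<Union>H\<close>.\<close>

type_synonym 'v hgraph = "'v set set"

definition hypergraph :: "'v hgraph \<Rightarrow> bool" where
  "hypergraph H \<longleftrightarrow> finite (\<Union>H) \<and> {} \<notin> H \<and> (\<forall>x\<in>\<Union>H. {x} \<in> H)"

definition induced :: "'v hgraph \<Rightarrow> 'v set \<Rightarrow> 'v hgraph" where
  "induced H X = {Z \<in> H. Z \<subseteq> X}"

definition delete :: "'v hgraph \<Rightarrow> 'v set \<Rightarrow> 'v hgraph" where
  "delete H X = induced H (\<Union>H - X)"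

definition hconnected :: "'v hgraph \<Rightarrow> bool" where
  "hconnected H \<longleftrightarrow>
     \<not> (\<exists>X1 X2. X1 \<noteq> {} \<and> X2 \<noteq> {} \<and> X1 \<inter> X2 = {} \<and> X1 \<union> X2 = \<Union>H \<and>
               H = induced H X1 \<union> induced H X2)"

definition decomposition :: "'v hgraph \<Rightarrow> 'v set set \<Rightarrow> bool" where
  "decomposition H P \<longleftrightarrow> partition_on (\<Union>H) P \<and> H = (\<Union>X\<in>P. induced H X) \<and>
     (\<forall>X\<in>P. hconnected (induced H X))"

definition components :: "'v hgraph \<Rightarrow> 'v hgraph set" where
  "components H = induced H ` (THE P. decomposition H P)"

lemma Union_induced:
  assumes "hypergraph H" "X \<subseteq> \<Union>H"
  shows "\<Union>(induced H X) = X"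
  using assms unfolding hypergraph_def induced_def by fastforce

lemma hypergraph_induced: "hypergraph H \<Longrightarrow> hypergraph (induced H X)"
  unfolding hypergraph_def induced_def
  by (auto intro: finite_subset[of _ "\<Union>H"])

lemma induced_induced: "Y \<subseteq> X \<Longrightarrow> induced (induced H X) Y = induced H Y"
  unfolding induced_def by auto

lemma Union_delete: "hypergraph H \<Longrightarrow> \<Union>(delete H X) = \<Union>H - X"
  unfolding delete_def by (rule Union_induced) auto

lemma hypergraph_delete: "hypergraph H \<Longrightarrow> hypergraph (delete H X)"
  unfolding delete_def by (rule hypergraph_induced)

lemma decompositionD:
  assumes "decomposition H P"
  shows "\<Union>P = \<Union>H" "disjoint P" "{} \<notin> P" "H = (\<Union>X\<in>P. induced H X)"
    "\<And>X. X \<in> P \<Longrightarrow> hconnected (induced H X)"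
  using assms unfolding decomposition_def partition_on_def by blast+

lemma decomposition_exists:
  assumes "hypergraph H"
  shows "\<exists>P. decomposition H P"
  using assms
proof (induction "card (\<Union>H)" arbitrary: H rule: less_induct)
  case less
  have fin: "finite (\<Union>H)" and ne: "{} \<notin> H"
    using less.prems by (auto simp: hypergraph_def)
  show ?case
  proof (cases "hconnected H")
    case True
    have full: "induced H (\<Union>H) = H" by (auto simp: induced_def)
    show ?thesis
    proof (cases "\<Union>H = {}")
      case True
      then have "H = {}" using ne by auto
      then have "decomposition H {}" by (simp add: decomposition_def partition_on_def)
      then show ?thesis ..
    next
      case False
      then have "decomposition H {\<Union>H}"
        using \<open>hconnected H\<close> full by (simp add: decomposition_def partition_on_space)
      then show ?thesis ..
    qed
  next
    case False
    then obtain X1 X2 where X: "X1 \<noteq> {}" "X2 \<noteq> {}" "X1 \<inter> X2 = {}" "X1 \<union> X2 = \<Union>H"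
      "H = induced H X1 \<union> induced H X2"
      unfolding hconnected_def by auto
    have sub: "X1 \<subseteq> \<Union>H" "X2 \<subseteq> \<Union>H" "X1 \<noteq> \<Union>H" "X2 \<noteq> \<Union>H" using X(1-4) by auto
    have U: "\<Union>(induced H X1) = X1" "\<Union>(induced H X2) = X2"
      using Union_induced[OF less.prems] sub by auto
    have "card X1 < card (\<Union>H)" "card X2 < card (\<Union>H)"
      using sub fin by (auto intro!: psubset_card_mono)
    with less.hyps[of "induced H X1"] less.hyps[of "induced H X2"]
    obtain P1 P2 where P: "decomposition (induced H X1) P1" "decomposition (induced H X2) P2"
      using U hypergraph_induced[OF less.prems] by metis
    have P1: "partition_on X1 P1" "induced H X1 = (\<Union>X\<in>P1. induced (induced H X1) X)"
        "\<forall>X\<in>P1. hconnected (induced (induced H X1) X)"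
      and P2: "partition_on X2 P2" "induced H X2 = (\<Union>X\<in>P2. induced (induced H X2) X)"
        "\<forall>X\<in>P2. hconnected (induced (induced H X2) X)"
      using P U by (auto simp only: decomposition_def)
    have s1: "induced (induced H X1) X = induced H X" if "X \<in> P1" for X
      using that P1(1) by (intro induced_induced) (auto simp: partition_on_def)
    have s2: "induced (induced H X2) X = induced H X" if "X \<in> P2" for X
      using that P2(1) by (intro induced_induced) (auto simp: partition_on_def)
    have e1: "induced H X1 = (\<Union>X\<in>P1. induced H X)" using P1(2) s1 by simp
    have e2: "induced H X2 = (\<Union>X\<in>P2. induced H X)" using P2(2) s2 by simp
    have U1: "\<Union>P1 = X1" "\<Union>P2 = X2" using P1(1) P2(1) by (auto simp: partition_on_def)
    have "disjoint (P1 \<union> P2)"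
      using partition_onD2[OF P1(1)] partition_onD2[OF P2(1)] U1 X(3) by (intro disjoint_union) auto
    moreover have "\<Union>(P1 \<union> P2) = \<Union>H" using U1 X(4) by simp
    ultimately have "partition_on (\<Union>H) (P1 \<union> P2)"
      using partition_onD3[OF P1(1)] partition_onD3[OF P2(1)] by (simp add: partition_on_def)
    moreover have "induced H X1 \<union> induced H X2 = (\<Union>X\<in>P1 \<union> P2. induced H X)"
      by (simp only: UN_Un e1 e2)
    then have "H = (\<Union>X\<in>P1 \<union> P2. induced H X)" by (rule trans[OF X(5)])
    moreover have "\<forall>X\<in>P1 \<union> P2. hconnected (induced H X)"
      using P1(3) P2(3) s1 s2 by auto
    ultimately have "decomposition H (P1 \<union> P2)" unfolding decomposition_def by blast
    then show ?thesis ..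
  qed
qed

lemma decomposition_block_subset:
  assumes H: "hypergraph H" and P: "decomposition H P" and Q: "decomposition H Q"
    and "X \<in> P" "Y \<in> Q" "X \<inter> Y \<noteq> {}"
  shows "X \<subseteq> Y"
proof (rule ccontr)
  assume "\<not> X \<subseteq> Y"
  have XH: "X \<subseteq> \<Union>H" using decompositionD(1)[OF P] \<open>X \<in> P\<close> by blast
  have "Z \<subseteq> X \<inter> Y \<or> Z \<subseteq> X - Y" if "Z \<in> H" "Z \<subseteq> X" for Z
  proof -
    note dQ = decompositionD(2)[OF Q]
    have "Z \<in> (\<Union>X\<in>Q. induced H X)" using \<open>Z \<in> H\<close> decompositionD(4)[OF Q] by blast
    then obtain Y' where Y': "Y' \<in> Q" "Z \<subseteq> Y'" by (auto simp: induced_def)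
    show ?thesis
      using dQ Y' \<open>Y \<in> Q\<close> \<open>Z \<subseteq> X\<close> by (cases "Y' = Y") (auto simp: disjoint_def)
  qed
  then have "induced H X = induced (induced H X) (X \<inter> Y) \<union> induced (induced H X) (X - Y)"
    by (auto simp: induced_def)
  moreover have "\<Union>(induced H X) = X" using Union_induced[OF H XH] .
  moreover have "(X \<inter> Y) \<union> (X - Y) = X" "(X \<inter> Y) \<inter> (X - Y) = {}" "X - Y \<noteq> {}"
    using \<open>\<not> X \<subseteq> Y\<close> by auto
  ultimately have "\<not> hconnected (induced H X)"
    unfolding hconnected_def using \<open>X \<inter> Y \<noteq> {}\<close> by metis
  then show False using decompositionD(5)[OF P \<open>X \<in> P\<close>] by simp
qed

lemma decomposition_unique:
  assumes H: "hypergraph H" and P: "decomposition H P" and Q: "decomposition H Q"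
  shows "P = Q"
proof -
  have *: "P \<subseteq> Q" if P: "decomposition H P" and Q: "decomposition H Q" for P Q
  proof
    fix X assume "X \<in> P"
    have "X \<noteq> {}" "X \<subseteq> \<Union>H"
      using decompositionD(1,3)[OF P] \<open>X \<in> P\<close> by blast+
    then obtain x where "x \<in> X" "x \<in> \<Union>H" by blast
    moreover have "\<Union>Q = \<Union>H" by (rule decompositionD(1)[OF Q])
    ultimately obtain Y where "Y \<in> Q" "x \<in> Y" by blast
    then have "X = Y"
      using decomposition_block_subset[OF H P Q \<open>X \<in> P\<close> \<open>Y \<in> Q\<close>]
        decomposition_block_subset[OF H Q P \<open>Y \<in> Q\<close> \<open>X \<in> P\<close>] \<open>x \<in> X\<close> by auto
    then show "X \<in> Q" using \<open>Y \<in> Q\<close> by simp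
  qed
  show ?thesis using *[OF P Q] *[OF Q P] by auto
qed

lemma components_eq:
  assumes "hypergraph H" "decomposition H P"
  shows "components H = induced H ` P"
  unfolding components_def
  using the_equality[of "decomposition H" P] assms decomposition_unique by metis

lemma components_Union_subset:
  assumes "hypergraph H" "K \<in> components H"
  shows "\<Union>K \<subseteq> \<Union>H"
proof -
  obtain P where "decomposition H P" using decomposition_exists assms(1) by auto
  then obtain X where "K = induced H X" using assms components_eq by blast
  then show ?thesis by (auto simp: induced_def)
qed


section \<open>Constructs and linear constructs\<close>

text \<open>The subtrees of a node of a construct live on pairwise disjoint nonempty carriers, hence are
  distinct, so a finite set of subtrees represents a non-planar tree.\<close>

datatype 'v ctree = Node (root_label: "'v set") (subtrees: "'v ctree fset")

inductive is_construct :: "'v hgraph \<Rightarrow> 'v ctree \<Rightarrow> bool" where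
  "Y \<noteq> {} \<Longrightarrow> Y \<subseteq> \<Union>H \<Longrightarrow>
   (\<And>K. K \<in> components (delete H Y) \<Longrightarrow> is_construct K (T K)) \<Longrightarrow>
   fset Ts = T ` components (delete H Y) \<Longrightarrow>
   is_construct H (Node Y Ts)"

type_synonym 'v lin = "'v ctree \<Rightarrow>\<^sub>0 real"

definition scale :: "real \<Rightarrow> ('t \<Rightarrow>\<^sub>0 real) \<Rightarrow> ('t \<Rightarrow>\<^sub>0 real)" where
  "scale r f = Poly_Mapping.map ((*) r) f"

text \<open>The multilinear extension to formal linear combinations of a function \<open>f\<close> defined on
  \<open>I\<close>-indexed families of basis elements.\<close>

definition multilinear ::
  "'i set \<Rightarrow> (('i \<Rightarrow> 't) \<Rightarrow> ('s \<Rightarrow>\<^sub>0 real)) \<Rightarrow> ('i \<Rightarrow> ('t \<Rightarrow>\<^sub>0 real)) \<Rightarrow> ('s \<Rightarrow>\<^sub>0 real)" where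
  "multilinear I f F =
     (\<Sum>T \<in> (\<Pi>\<^sub>E i\<in>I. Poly_Mapping.keys (F i)).
        scale (\<Prod>i\<in>I. Poly_Mapping.lookup (F i) (T i)) (f T))"

lemma multilinear_cong [fundef_cong]:
  assumes "I = I'" "f = f'" "\<And>i. i \<in> I' \<Longrightarrow> F i = F' i"
  shows "multilinear I f F = multilinear I' f' F'"
proof -
  have "(\<Pi>\<^sub>E i\<in>I. Poly_Mapping.keys (F i)) = (\<Pi>\<^sub>E i\<in>I'. Poly_Mapping.keys (F' i))"
    unfolding assms(1) by (rule PiE_cong) (simp add: assms(3))
  moreover have "(\<Prod>i\<in>I. Poly_Mapping.lookup (F i) (T i)) =
      (\<Prod>i\<in>I'. Poly_Mapping.lookup (F' i) (T i))" for T
    using assms(1,3) by (intro prod.cong) auto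
  ultimately show ?thesis unfolding multilinear_def assms(2) by simp
qed

definition node_lin :: "'v set \<Rightarrow> 'v hgraph set \<Rightarrow> ('v hgraph \<Rightarrow> 'v lin) \<Rightarrow> 'v lin" where
  "node_lin Y \<K> F =
     multilinear \<K> (\<lambda>T. Poly_Mapping.single (Node Y (Abs_fset (T ` \<K>))) 1) F"

lemma node_lin_cong [fundef_cong]:
  assumes "Y = Y'" "\<K> = \<K>'" "\<And>K. K \<in> \<K>' \<Longrightarrow> F K = F' K"
  shows "node_lin Y \<K> F = node_lin Y' \<K>' F'"
  unfolding node_lin_def using assms by (intro multilinear_cong) auto


section \<open>Teams and clans\<close>

text \<open>The members of a team have pairwise disjoint carriers, so the family of members is given by
  the set of its members, each member serving as its own index. (In a strict team on a nonempty
  carrier all members are nonempty, so members with different indices are different.)\<close>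

type_synonym 'v team = "'v hgraph set \<times> 'v hgraph"

definition is_universe :: "'v hgraph set \<Rightarrow> bool" where
  "is_universe U \<longleftrightarrow> (\<forall>H\<in>U. hypergraph H \<and> hconnected H)"

definition preteam :: "'v hgraph set \<Rightarrow> 'v team \<Rightarrow> bool" where
  "preteam U = (\<lambda>(A, H). finite A \<and> A \<subseteq> U \<and> H \<in> U \<and>
     disjoint_family_on Union A \<and> \<Union>H = (\<Union>a\<in>A. \<Union>a))"

definition choice :: "'v hgraph set \<Rightarrow> 'v hgraph set \<Rightarrow> ('v hgraph \<Rightarrow> 'v set) \<Rightarrow> bool" where
  "choice A B X \<longleftrightarrow> B \<noteq> {} \<and> B \<subseteq> A \<and> (\<forall>b\<in>B. X b \<noteq> {} \<and> X b \<subseteq> \<Union>b)"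

text \<open>The set written \<open>A\<close> with a tilde in the literature.\<close>

definition split_members ::
  "'v hgraph set \<Rightarrow> 'v hgraph set \<Rightarrow> ('v hgraph \<Rightarrow> 'v set) \<Rightarrow> 'v hgraph set" where
  "split_members A B X = (A - B) \<union> (\<Union>b\<in>B. components (delete b (X b)))"

definition strict_team :: "'v hgraph set \<Rightarrow> 'v team \<Rightarrow> bool" where
  "strict_team U = (\<lambda>(A, H). preteam U (A, H) \<and>
     (\<forall>B X. choice A B X \<longrightarrow> (\<forall>a \<in> split_members A B X.
        a \<in> U \<and> (\<exists>K \<in> components (delete H (\<Union>b\<in>B. X b)). \<Union>a \<subseteq> \<Union>K))))"

text \<open>The team on a component \<open>K\<close> of \<open>H\<close> without \<open>\<Union>b\<in>B. X b\<close>.\<close>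

definition subteam ::
  "'v hgraph set \<Rightarrow> 'v hgraph set \<Rightarrow> ('v hgraph \<Rightarrow> 'v set) \<Rightarrow> 'v hgraph \<Rightarrow> 'v team" where
  "subteam A B X K = ({a \<in> split_members A B X. \<Union>a \<subseteq> \<Union>K}, K)"

definition strict_clan :: "'v hgraph set \<Rightarrow> 'v team set \<Rightarrow> bool" where
  "strict_clan U \<Xi> \<longleftrightarrow> (\<forall>\<tau>\<in>\<Xi>. strict_team U \<tau>) \<and>
     (\<forall>A H B X. (A, H) \<in> \<Xi> \<longrightarrow> choice A B X \<longrightarrow>
        (\<forall>K \<in> components (delete H (\<Union>b\<in>B. X b)). subteam A B X K \<in> \<Xi>))"

definition graft :: "'v hgraph set \<Rightarrow> 'v hgraph \<Rightarrow> 'v hgraph set \<Rightarrow> 'v hgraph set" where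
  "graft A a0 A' = (A - {a0}) \<union> A'"

definition associative_clan :: "'v team set \<Rightarrow> bool" where
  "associative_clan \<Xi> \<longleftrightarrow>
     (\<forall>A H a0 A'. (A, H) \<in> \<Xi> \<longrightarrow> a0 \<in> A \<longrightarrow> (A', a0) \<in> \<Xi> \<longrightarrow> (graft A a0 A', H) \<in> \<Xi>)"


section \<open>The shuffle product\<close>

text \<open>A delegation assigns a construct to each member of a team. Membership of the support in a
  given clan is left to the theorems; the preteam condition here is what makes the recursion
  below terminate.\<close>

definition delegation :: "'v team \<Rightarrow> ('v hgraph \<Rightarrow> 'v ctree) \<Rightarrow> bool" where
  "delegation \<tau> C \<longleftrightarrow> preteam {K. hypergraph K \<and> hconnected K} \<tau> \<and> (\<forall>a\<in>fst \<tau>. is_construct a (C a))"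

text \<open>The family of constructs on \<^term>\<open>split_members A B (\<lambda>b. root_label (C b))\<close>: on a component of
  a split member \<open>b\<close> it is the subtree of \<open>C b\<close> that is a construct of that component.\<close>

definition split_constructs ::
  "'v hgraph set \<Rightarrow> 'v hgraph set \<Rightarrow> ('v hgraph \<Rightarrow> 'v ctree) \<Rightarrow> ('v hgraph \<Rightarrow> 'v ctree)" where
  "split_constructs A B C a =
     (if a \<in> A - B then C a
      else THE T. \<exists>b\<in>B. a \<in> components (delete b (root_label (C b))) \<and>
                        T |\<in>| subtrees (C b) \<and> is_construct a T)"

lemma delegation_component_card:
  assumes "delegation (A, H) C" "B \<noteq> {}" "B \<subseteq> A"
    and "K \<in> components (delete H (\<Union>b\<in>B. root_label (C b)))"
  shows "card (\<Union>K) < card (\<Union>H)"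
proof -
  have H: "hypergraph H" and UH: "\<Union>H = (\<Union>a\<in>A. \<Union>a)" and C: "\<forall>a\<in>A. is_construct a (C a)"
    using assms(1) by (auto simp: delegation_def preteam_def)
  obtain b where b: "b \<in> B" "b \<in> A" using assms(2,3) by auto
  with C have "is_construct b (C b)" by auto
  then have "root_label (C b) \<noteq> {}" "root_label (C b) \<subseteq> \<Union>b" by (metis is_construct.cases ctree.sel(1))+
  then obtain x where x: "x \<in> root_label (C b)" "x \<in> \<Union>H" using UH b by blast
  have "\<Union>K \<subseteq> \<Union>H - (\<Union>b\<in>B. root_label (C b))"
    using components_Union_subset[OF hypergraph_delete[OF H] assms(4)] Union_delete[OF H] by simp
  then have "\<Union>K \<subset> \<Union>H" using x b by blast
  then show ?thesis using H by (intro psubset_card_mono) (auto simp: hypergraph_def)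
qed

text \<open>\<open>shuffle_part q \<tau> B C\<close> is the \<open>B\<close>-part of the shuffle product \<open>shuffle q \<tau> C\<close> of the
  delegation with support \<open>\<tau>\<close> and constructs \<open>C\<close>.\<close>

function shuffle :: "real \<Rightarrow> 'v team \<Rightarrow> ('v hgraph \<Rightarrow> 'v ctree) \<Rightarrow> 'v lin"
  and shuffle_part :: "real \<Rightarrow> 'v team \<Rightarrow> 'v hgraph set \<Rightarrow> ('v hgraph \<Rightarrow> 'v ctree) \<Rightarrow> 'v lin"
where
  "shuffle q (A, H) C =
     (\<Sum>B \<in> Pow A - {{}}. scale (q ^ (card B - 1)) (shuffle_part q (A, H) B C))"
| "shuffle_part q (A, H) B C =
     (if delegation (A, H) C \<and> B \<noteq> {} \<and> B \<subseteq> A then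
        node_lin (\<Union>b\<in>B. root_label (C b)) (components (delete H (\<Union>b\<in>B. root_label (C b))))
          (\<lambda>K. shuffle q (subteam A B (\<lambda>b. root_label (C b)) K) (split_constructs A B C))
      else 0)"
  by pat_completeness auto
termination
proof (relation "measure (\<lambda>x. case x of Inl (q, (A, H), C) \<Rightarrow> 2 * card (\<Union>H) + 1
                                       | Inr (q, (A, H), B, C) \<Rightarrow> 2 * card (\<Union>H))")
  fix q :: real and A B :: "'v hgraph set" and H K :: "'v hgraph" and C :: "'v hgraph \<Rightarrow> 'v ctree"
  assume "delegation (A, H) C \<and> B \<noteq> {} \<and> B \<subseteq> A"
    and "K \<in> components (delete H (\<Union>b\<in>B. root_label (C b)))"
  then have "card (\<Union>K) < card (\<Union>H)" by (blast intro: delegation_component_card)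
  then show "(Inl (q, subteam A B (\<lambda>b. root_label (C b)) K, split_constructs A B C),
      Inr (q, (A, H), B, C))
      \<in> measure (\<lambda>x. case x of Inl (q, (A, H), C) \<Rightarrow> 2 * card (\<Union>H) + 1
                              | Inr (q, (A, H), B, C) \<Rightarrow> 2 * card (\<Union>H))"
    by (simp add: subteam_def)
qed simp_all

declare shuffle.simps [simp del] shuffle_part.simps [simp del]

text \<open>Extension to linear delegations.\<close>

definition shuffle_lin :: "real \<Rightarrow> 'v team \<Rightarrow> ('v hgraph \<Rightarrow> 'v lin) \<Rightarrow> 'v lin" where
  "shuffle_lin q \<tau> F = multilinear (fst \<tau>) (\<lambda>C. shuffle q \<tau> C) F"

definition shuffle_part_lin ::
  "real \<Rightarrow> 'v team \<Rightarrow> 'v hgraph set \<Rightarrow> ('v hgraph \<Rightarrow> 'v lin) \<Rightarrow> 'v lin" where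
  "shuffle_part_lin q \<tau> B F = multilinear (fst \<tau>) (\<lambda>C. shuffle_part q \<tau> B C) F"

definition put_at :: "('v hgraph \<Rightarrow> 'v ctree) \<Rightarrow> 'v hgraph \<Rightarrow> 'v lin \<Rightarrow> ('v hgraph \<Rightarrow> 'v lin)" where
  "put_at C a0 D = (\<lambda>a. Poly_Mapping.single (C a) 1)(a0 := D)"

end

theory Submission
  imports Defs
begin

text \<open>
  The proof is by induction on the size of the carrier of \<open>H\<close>. Expanding \<open>\<ast>\<^sub>B\<close> on both sides of the
  polydendriform equation gives nodes with the same root label \<open>Y\<close>, hence with the same components
  \<open>K\<close> of \<open>H \<setminus> Y\<close>. Over each \<open>K\<close> the team on the left-hand side arises from the one on the right-hand
  side by simultaneous grafts: at \<open>a0\<close> alone if \<open>B\<close> avoids \<open>A'\<close>, and otherwise at the components of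
  \<open>a0\<close> minus the roots chosen in \<open>A'\<close>. The induction hypothesis, iterated over these grafts, and
  multilinearity then identify the subtrees. The equation for the total product is the sum of the
  equations for the parts, with \<open>q\<^bsup>|B \<union> B'|-1\<^esup> = q\<^bsup>|B \<union> {a0}|-1\<^esup> q\<^bsup>|B'|-1\<^esup>\<close>.
\<close>

text \<open>A single graft is not stable under the recursion: once roots inside \<open>a0\<close>
  are removed, \<open>a0\<close> breaks into components, and several of these may fall into the same
  component \<open>K\<close> of the rest of \<open>H\<close>, so several teams must be grafted over
  \<open>K\<close> at once. Associativity of the clan keeps every intermediate team of the iteration
  in the clan, and all of them have ambient hypergraph \<open>K\<close>, so the one-graft statement
  at \<open>K\<close> serves every step. The induction involves total products only, because the
  subtrees below a root are total products; the equations for the parts at \<open>H\<close> follow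
  from total equations on strictly smaller carriers. Two matters of encoding shape the rest. Members
  index themselves, so carriers must be nonempty before disjointness makes members distinct;
  strictness supplies this on a nonempty ambient carrier. And the one-graft statement speaks of
  constructs, not arbitrary trees, so the trees in the support of a product must be known to be
  constructs before it is used under a linear extension.\<close>

abbreviation (input) lookup :: "('t \<Rightarrow>\<^sub>0 real) \<Rightarrow> 't \<Rightarrow> real" where
  "lookup \<equiv> Poly_Mapping.lookup"

abbreviation (input) keys :: "('t \<Rightarrow>\<^sub>0 real) \<Rightarrow> 't set" where
  "keys \<equiv> Poly_Mapping.keys"

section \<open>Linear and multilinear extension\<close>

lemma lookup_scale [simp]: "lookup (scale r f) x = r * lookup f x"
  unfolding scale_def by (simp add: Poly_Mapping.map.rep_eq when_def)

interpretation lin: vector_space "scale :: real \<Rightarrow> ('t \<Rightarrow>\<^sub>0 real) \<Rightarrow> _"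
  by unfold_locales (auto intro!: poly_mapping_eqI simp: lookup_add algebra_simps)

definition linear_ext :: "('t \<Rightarrow> ('s \<Rightarrow>\<^sub>0 real)) \<Rightarrow> ('t \<Rightarrow>\<^sub>0 real) \<Rightarrow> ('s \<Rightarrow>\<^sub>0 real)" where
  "linear_ext g D = (\<Sum>t\<in>keys D. scale (lookup D t) (g t))"

text \<open>Coefficients vanish off the support, so the index set may be enlarged. Supports shrink
  under cancellation, and sums of several combinations can only be compared over a common finite
  index set.\<close>

lemma linear_ext_superset:
  assumes "finite S" "keys D \<subseteq> S"
  shows "linear_ext g D = (\<Sum>t\<in>S. scale (lookup D t) (g t))"
  unfolding linear_ext_def using assms
  by (intro sum.mono_neutral_left) (auto simp: in_keys_iff)

lemma linear_ext_cong:
  assumes "\<And>t. t \<in> keys D \<Longrightarrow> g t = g' t"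
  shows "linear_ext g D = linear_ext g' D"
  unfolding linear_ext_def using assms by (intro sum.cong) auto

lemma linear_ext_single [simp]: "linear_ext g (Poly_Mapping.single t 1) = g t"
  by (simp add: linear_ext_def)

lemma linear_ext_zero [simp]: "linear_ext g 0 = 0"
  by (simp add: linear_ext_def)

lemma linear_ext_scale: "linear_ext g (scale r D) = scale r (linear_ext g D)"
proof -
  have "keys (scale r D) \<subseteq> keys D" by (auto simp: in_keys_iff)
  then have "linear_ext g (scale r D) = (\<Sum>t\<in>keys D. scale (lookup (scale r D) t) (g t))"
    by (intro linear_ext_superset) auto
  then show ?thesis by (simp add: linear_ext_def lin.scale_sum_right)
qed

lemma linear_ext_add: "linear_ext g (D + E) = linear_ext g D + linear_ext g E"
proof -
  let ?S = "keys D \<union> keys E"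
  have "linear_ext g D' = (\<Sum>t\<in>?S. scale (lookup D' t) (g t))" if "D' \<in> {D, E, D + E}" for D'
    using that Poly_Mapping.keys_add[of D E] by (intro linear_ext_superset) auto
  then show ?thesis by (simp add: lookup_add lin.scale_left_distrib sum.distrib)
qed

lemma linear_ext_sum: "linear_ext g (\<Sum>j\<in>S. G j) = (\<Sum>j\<in>S. linear_ext g (G j))"
  by (induction S rule: infinite_finite_induct) (auto simp: linear_ext_add)

lemma linear_ext_sum_left:
  "linear_ext (\<lambda>t. \<Sum>j\<in>S. g j t) D = (\<Sum>j\<in>S. linear_ext (g j) D)"
  unfolding linear_ext_def lin.scale_sum_right by (rule sum.swap)

lemma linear_ext_scale_left: "linear_ext (\<lambda>t. scale r (g t)) D = scale r (linear_ext g D)"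
  unfolding linear_ext_def lin.scale_sum_right by (simp add: mult.commute)

section \<open>Multilinear extension and its composition laws\<close>

text \<open>A family \<open>T\<close> that leaves the support at one index has a zero factor in its
  coefficient.\<close>

lemma multilinear_superset:
  assumes "finite I" "\<And>i. i \<in> I \<Longrightarrow> finite (S i)" "\<And>i. i \<in> I \<Longrightarrow> keys (F i) \<subseteq> S i"
  shows "multilinear I f F = (\<Sum>T\<in>(\<Pi>\<^sub>E i\<in>I. S i). scale (\<Prod>i\<in>I. lookup (F i) (T i)) (f T))"
  unfolding multilinear_def
proof (rule sum.mono_neutral_left)
  show "finite (\<Pi>\<^sub>E i\<in>I. S i)" using assms by (intro finite_PiE)
  show "(\<Pi>\<^sub>E i\<in>I. keys (F i)) \<subseteq> (\<Pi>\<^sub>E i\<in>I. S i)" using assms by (intro PiE_mono) auto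
  show "\<forall>T\<in>(\<Pi>\<^sub>E i\<in>I. S i) - (\<Pi>\<^sub>E i\<in>I. keys (F i)).
      scale (\<Prod>i\<in>I. lookup (F i) (T i)) (f T) = 0"
  proof
    fix T assume T: "T \<in> (\<Pi>\<^sub>E i\<in>I. S i) - (\<Pi>\<^sub>E i\<in>I. keys (F i))"
    then obtain i where "i \<in> I" "T i \<notin> keys (F i)" by (auto simp: PiE_iff)
    then have "(\<Prod>i\<in>I. lookup (F i) (T i)) = 0"
      using assms(1) by (auto simp: in_keys_iff intro: prod_zero)
    then show "scale (\<Prod>i\<in>I. lookup (F i) (T i)) (f T) = 0" by simp
  qed
qed

lemma multilinear_fun_cong:
  assumes "\<And>T. T \<in> (\<Pi>\<^sub>E i\<in>I. keys (F i)) \<Longrightarrow> f T = f' T"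
  shows "multilinear I f F = multilinear I f' F"
  unfolding multilinear_def using assms by (intro sum.cong) auto

text \<open>Currying: a family on \<open>insert k I\<close> is a value at \<open>k\<close> together
  with a family on \<open>I\<close>. This is the induction step for simultaneous grafts.\<close>

lemma multilinear_insert:
  assumes "finite I" "k \<notin> I"
  shows "multilinear (insert k I) f F =
    linear_ext (\<lambda>t. multilinear I (\<lambda>T. f (T(k := t))) F) (F k)"
proof -
  let ?P = "\<Pi>\<^sub>E i\<in>I. keys (F i)"
  let ?g = "\<lambda>T. scale (\<Prod>i\<in>insert k I. lookup (F i) (T i)) (f T)"
  have fin: "finite ?P" using assms by (intro finite_PiE) auto
  have coeff: "(\<Prod>i\<in>I. lookup (F i) (if i = k then t else T i)) = (\<Prod>i\<in>I. lookup (F i) (T i))" for T t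
    using assms by (intro prod.cong) auto
  have "multilinear (insert k I) f F = (\<Sum>T\<in>(\<lambda>(t, T). T(k := t)) ` (keys (F k) \<times> ?P). ?g T)"
    unfolding multilinear_def PiE_insert_eq ..
  also have "\<dots> = (\<Sum>(t, T)\<in>keys (F k) \<times> ?P. ?g (T(k := t)))"
    using assms inj_combinator[of k I "\<lambda>i. keys (F i)"]
    by (subst sum.reindex) (auto simp: case_prod_unfold)
  also have "\<dots> = (\<Sum>t\<in>keys (F k). \<Sum>T\<in>?P. ?g (T(k := t)))"
    by (rule sum.cartesian_product[symmetric])
  also have "\<dots> = linear_ext (\<lambda>t. multilinear I (\<lambda>T. f (T(k := t))) F) (F k)"
    using assms by (simp add: linear_ext_def multilinear_def lin.scale_sum_right coeff)
  finally show ?thesis .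
qed

lemma multilinear_singles:
  assumes "finite I"
  shows "multilinear I f (\<lambda>i. Poly_Mapping.single (t i) 1) = f (restrict t I)"
proof -
  have "(\<Pi>\<^sub>E i\<in>I. keys (Poly_Mapping.single (t i) (1::real))) = {restrict t I}"
    using PiE_singleton[of "restrict t I" I] by (simp cong: PiE_cong)
  then show ?thesis using assms by (simp add: multilinear_def)
qed

text \<open>Basis elements everywhere except at \<open>a0\<close> leave one linear variable. The
  hypothesis on \<open>f\<close> is there because \<open>multilinear\<close> evaluates
  \<open>f\<close> at families that are \<open>undefined\<close> outside \<open>A\<close>, whereas
  \<open>C(a0 := t)\<close> is an arbitrary total function.\<close>

lemma multilinear_put_at:
  assumes "finite A" "a0 \<in> A" "\<And>T. f (restrict T A) = f T"
  shows "multilinear A f (put_at C a0 D) = linear_ext (\<lambda>t. f (C(a0 := t))) D"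
proof -
  have "multilinear (insert a0 (A - {a0})) f (put_at C a0 D) =
      linear_ext (\<lambda>t. multilinear (A - {a0}) (\<lambda>T. f (T(a0 := t))) (put_at C a0 D)) D"
    using assms by (subst multilinear_insert) (auto simp: put_at_def)
  also have "\<dots> = linear_ext (\<lambda>t. f (C(a0 := t))) D"
  proof (rule linear_ext_cong)
    fix t
    have "multilinear (A - {a0}) (\<lambda>T. f (T(a0 := t))) (put_at C a0 D) =
        multilinear (A - {a0}) (\<lambda>T. f (T(a0 := t))) (\<lambda>a. Poly_Mapping.single (C a) 1)"
      by (intro multilinear_cong) (auto simp: put_at_def)
    also have "\<dots> = f ((restrict C (A - {a0}))(a0 := t))"
      using assms by (intro multilinear_singles) auto
    also have "\<dots> = f (restrict (C(a0 := t)) A)"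
      using assms by (intro arg_cong[of _ _ f]) (auto simp: restrict_def)
    finally show "multilinear (A - {a0}) (\<lambda>T. f (T(a0 := t))) (put_at C a0 D) = f (C(a0 := t))"
      using assms(3) by simp
  qed
  finally show ?thesis using assms(2) by (simp add: insert_absorb)
qed

text \<open>Expanding the product of the coefficient sums gives one term for each choice function
  \<open>\<phi>\<close> selecting a summand at every index. The sets \<open>R i\<close> collect the
  basis elements that can occur before cancellation.\<close>

lemma multilinear_expand:
  assumes "finite I" "\<And>i. i \<in> I \<Longrightarrow> finite (S i)"
  shows "multilinear I f (\<lambda>i. \<Sum>j\<in>S i. scale (c i j) (G i j)) =
    (\<Sum>\<phi>\<in>(\<Pi>\<^sub>E i\<in>I. S i). scale (\<Prod>i\<in>I. c i (\<phi> i)) (multilinear I f (\<lambda>i. G i (\<phi> i))))"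
proof -
  define R where "R i = (\<Union>j\<in>S i. keys (G i j))" for i
  have finR: "finite (R i)" if "i \<in> I" for i using assms(2)[OF that] by (auto simp: R_def)
  have lookup_F: "lookup (\<Sum>j\<in>S i. scale (c i j) (G i j)) t = (\<Sum>j\<in>S i. c i j * lookup (G i j) t)"
    for i t by (simp add: lookup_sum)
  have keys_F: "keys (\<Sum>j\<in>S i. scale (c i j) (G i j)) \<subseteq> R i" for i
  proof
    fix t assume "t \<in> keys (\<Sum>j\<in>S i. scale (c i j) (G i j))"
    then have "(\<Sum>j\<in>S i. c i j * lookup (G i j) t) \<noteq> 0" by (simp only: in_keys_iff lookup_F not_False_eq_True)
    then obtain j where "j \<in> S i" "c i j * lookup (G i j) t \<noteq> 0" by (meson sum.not_neutral_contains_not_neutral)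
    then show "t \<in> R i" by (auto simp: R_def in_keys_iff)
  qed
  have "multilinear I f (\<lambda>i. \<Sum>j\<in>S i. scale (c i j) (G i j)) =
      (\<Sum>T\<in>(\<Pi>\<^sub>E i\<in>I. R i). scale (\<Prod>i\<in>I. \<Sum>j\<in>S i. c i j * lookup (G i j) (T i)) (f T))"
    using assms(1) finR keys_F by (subst multilinear_superset[where S = R]) (auto simp: lookup_F)
  also have "\<dots> = (\<Sum>T\<in>(\<Pi>\<^sub>E i\<in>I. R i). \<Sum>\<phi>\<in>(\<Pi>\<^sub>E i\<in>I. S i).
      scale (\<Prod>i\<in>I. c i (\<phi> i)) (scale (\<Prod>i\<in>I. lookup (G i (\<phi> i)) (T i)) (f T)))"
    using assms by (subst prod_sum_PiE) (auto simp: prod.distrib lin.scale_sum_left)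
  also have "\<dots> = (\<Sum>\<phi>\<in>(\<Pi>\<^sub>E i\<in>I. S i). \<Sum>T\<in>(\<Pi>\<^sub>E i\<in>I. R i).
      scale (\<Prod>i\<in>I. c i (\<phi> i)) (scale (\<Prod>i\<in>I. lookup (G i (\<phi> i)) (T i)) (f T)))"
    by (rule sum.swap)
  also have "\<dots> = (\<Sum>\<phi>\<in>(\<Pi>\<^sub>E i\<in>I. S i).
      scale (\<Prod>i\<in>I. c i (\<phi> i)) (multilinear I f (\<lambda>i. G i (\<phi> i))))"
  proof (rule sum.cong[OF refl])
    fix \<phi> assume \<phi>: "\<phi> \<in> (\<Pi>\<^sub>E i\<in>I. S i)"
    have "multilinear I f (\<lambda>i. G i (\<phi> i)) =
        (\<Sum>T\<in>(\<Pi>\<^sub>E i\<in>I. R i). scale (\<Prod>i\<in>I. lookup (G i (\<phi> i)) (T i)) (f T))"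
      using assms(1) finR \<phi> by (intro multilinear_superset) (auto simp: R_def PiE_iff)
    then show "(\<Sum>T\<in>(\<Pi>\<^sub>E i\<in>I. R i).
        scale (\<Prod>i\<in>I. c i (\<phi> i)) (scale (\<Prod>i\<in>I. lookup (G i (\<phi> i)) (T i)) (f T))) =
        scale (\<Prod>i\<in>I. c i (\<phi> i)) (multilinear I f (\<lambda>i. G i (\<phi> i)))"
      by (simp only: lin.scale_sum_right)
  qed
  finally show ?thesis .
qed

text \<open>A Fubini rule: a family of families over disjoint blocks is one family on their union.
  It will sort the linear variables by the component into which they fall.\<close>

lemma multilinear_multilinear:
  assumes fin: "finite I" "\<And>i. i \<in> I \<Longrightarrow> finite (J i)" and disj: "disjoint_family_on J I"
  shows "multilinear I f (\<lambda>i. multilinear (J i) (g i) F) =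
    multilinear (\<Union>i\<in>I. J i) (\<lambda>T. multilinear I f (\<lambda>i. g i (restrict T (J i)))) F"
proof -
  let ?U = "\<Union>i\<in>I. J i"
  let ?S = "\<lambda>i. \<Pi>\<^sub>E l\<in>J i. keys (F l)"
  \<comment> \<open>By disjointness \<open>\<kappa> l\<close> is the block containing
    \<open>l\<close>. Gluing \<open>\<phi>\<close> reads \<open>\<phi> (\<kappa> l)\<close> at
    \<open>l\<close>, and restriction to the blocks inverts this.\<close>
  define \<kappa> where "\<kappa> l = (THE i. i \<in> I \<and> l \<in> J i)" for l
  have \<kappa>: "\<kappa> l = i" if "i \<in> I" "l \<in> J i" for i l
    unfolding \<kappa>_def using that disj by (intro the_equality) (auto simp: disjoint_family_on_def)
  have "multilinear I f (\<lambda>i. multilinear (J i) (g i) F) =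
      (\<Sum>\<phi>\<in>(\<Pi>\<^sub>E i\<in>I. ?S i). scale (\<Prod>i\<in>I. \<Prod>l\<in>J i. lookup (F l) (\<phi> i l))
        (multilinear I f (\<lambda>i. g i (\<phi> i))))"
    unfolding multilinear_def[of "J _"] using fin
    by (intro multilinear_expand) (auto intro: finite_PiE)
  also have "\<dots> = (\<Sum>T\<in>(\<Pi>\<^sub>E l\<in>?U. keys (F l)). scale (\<Prod>l\<in>?U. lookup (F l) (T l))
        (multilinear I f (\<lambda>i. g i (restrict T (J i)))))"
  proof (rule sum.reindex_bij_witness[where
        i = "\<lambda>T. \<lambda>i\<in>I. restrict T (J i)" and j = "\<lambda>\<phi>. \<lambda>l\<in>?U. \<phi> (\<kappa> l) l"], goal_cases)
    case (1 \<phi>)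
    show ?case
    proof
      fix i
      show "(\<lambda>i\<in>I. restrict (\<lambda>l\<in>?U. \<phi> (\<kappa> l) l) (J i)) i = \<phi> i"
      proof (cases "i \<in> I")
        case True
        then have "\<phi> i \<in> ?S i" using 1 by (auto simp: PiE_iff)
        then show ?thesis using True by (auto simp: fun_eq_iff \<kappa> PiE_iff extensional_def)
      next
        case False
        then show ?thesis using 1 by (auto simp: PiE_iff extensional_def)
      qed
    qed
  next
    case (2 \<phi>)
    have "\<phi> (\<kappa> l) l \<in> keys (F l)" if l: "l \<in> ?U" for l
    proof -
      obtain i where i: "i \<in> I" "l \<in> J i" using l by blast
      then have "\<phi> i \<in> ?S i" using 2 PiE_mem by fast
      then show ?thesis using i \<kappa> PiE_mem by fastforce
    qed
    then show ?case by (simp only: restrict_PiE_iff) blast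
  next
    case (3 T)
    show ?case
    proof
      fix l
      show "(\<lambda>l\<in>?U. (\<lambda>i\<in>I. restrict T (J i)) (\<kappa> l) l) l = T l"
      proof (cases "l \<in> ?U")
        case True
        then obtain i where "i \<in> I" "l \<in> J i" by blast
        then show ?thesis using True by (simp add: \<kappa>)
      next
        case False
        then show ?thesis using PiE_arb[OF 3 False] by (simp only: restrict_apply if_False)
      qed
    qed
  next
    case (4 T)
    then show ?case by (auto simp: PiE_iff)
  next
    case (5 \<phi>)
    have restr: "restrict (\<lambda>l\<in>?U. \<phi> (\<kappa> l) l) (J i) = \<phi> i" if "i \<in> I" for i
    proof -
      have "\<phi> i \<in> ?S i" using 5 that by (auto simp: PiE_iff)
      then show ?thesis using that by (auto simp: fun_eq_iff \<kappa> PiE_iff extensional_def)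
    qed
    have "(\<Prod>l\<in>?U. lookup (F l) ((\<lambda>l\<in>?U. \<phi> (\<kappa> l) l) l)) =
        (\<Prod>i\<in>I. \<Prod>l\<in>J i. lookup (F l) ((\<lambda>l\<in>?U. \<phi> (\<kappa> l) l) l))"
      using fin disj by (intro prod.UNION_disjoint) (auto simp: disjoint_family_on_def)
    also have "\<dots> = (\<Prod>i\<in>I. \<Prod>l\<in>J i. lookup (F l) (\<phi> i l))"
      by (intro prod.cong refl) (auto simp: \<kappa>)
    finally have "(\<Prod>l\<in>?U. lookup (F l) ((\<lambda>l\<in>?U. \<phi> (\<kappa> l) l) l)) =
        (\<Prod>i\<in>I. \<Prod>l\<in>J i. lookup (F l) (\<phi> i l))" .
    moreover have "multilinear I f (\<lambda>i. g i (restrict (\<lambda>l\<in>?U. \<phi> (\<kappa> l) l) (J i))) =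
        multilinear I f (\<lambda>i. g i (\<phi> i))"
      by (intro multilinear_cong refl) (simp only: restr)
    ultimately show ?case by simp
  qed
  finally show ?thesis by (simp only: multilinear_def[of ?U])
qed

lemma keys_multilinear:
  assumes "t \<in> keys (multilinear I f F)"
  obtains T where "T \<in> (\<Pi>\<^sub>E i\<in>I. keys (F i))" "t \<in> keys (f T)"
proof -
  have "(\<Sum>T \<in> (\<Pi>\<^sub>E i\<in>I. keys (F i)). (\<Prod>i\<in>I. lookup (F i) (T i)) * lookup (f T) t) \<noteq> 0"
    using assms by (simp add: in_keys_iff multilinear_def lookup_sum)
  then obtain T where "T \<in> (\<Pi>\<^sub>E i\<in>I. keys (F i))"
    "(\<Prod>i\<in>I. lookup (F i) (T i)) * lookup (f T) t \<noteq> 0"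
    by (meson sum.not_neutral_contains_not_neutral)
  then show ?thesis using that by (auto simp: in_keys_iff)
qed

lemma linear_ext_multilinear:
  "linear_ext h (multilinear I f F) = multilinear I (\<lambda>T. linear_ext h (f T)) F"
  unfolding multilinear_def by (simp add: linear_ext_sum linear_ext_scale)

text \<open>Presents an arbitrary linear combination as a multilinear extension in one variable, so
  that a graft at one member fits the same scheme as a graft at many.\<close>

lemma multilinear_singleton:
  "multilinear {k} (\<lambda>T. Poly_Mapping.single (T k) 1) F = F k"
proof -
  have "multilinear {k} (\<lambda>T. Poly_Mapping.single (T k) 1) F =
      linear_ext (\<lambda>t. Poly_Mapping.single t 1) (F k)"
    by (subst multilinear_insert) (simp_all add: multilinear_def)
  also have "\<dots> = F k"
  proof (rule poly_mapping_eqI)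
    fix x
    have "lookup (linear_ext (\<lambda>t. Poly_Mapping.single t 1) (F k)) x =
        (\<Sum>t\<in>keys (F k). if t = x then lookup (F k) t else 0)"
      unfolding linear_ext_def lookup_sum by (intro sum.cong) (auto simp: lookup_single)
    also have "\<dots> = lookup (F k) x" by (simp add: in_keys_iff)
    finally show "lookup (linear_ext (\<lambda>t. Poly_Mapping.single t 1) (F k)) x = lookup (F k) x" .
  qed
  finally show ?thesis .
qed

section \<open>Sums over nonempty subsets\<close>

lemma sum_Pow_insert:
  assumes "finite A" "a \<notin> A"
  shows "(\<Sum>B\<in>Pow (insert a A) - {{}}. f B) =
    (\<Sum>B\<in>Pow A - {{}}. f B) + (\<Sum>B\<in>Pow A. f (insert a B))"
proof -
  have "Pow (insert a A) - {{}} = (Pow A - {{}}) \<union> insert a ` Pow A" by (auto simp: Pow_insert)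
  moreover have "inj_on (insert a) (Pow A)" using assms(2) by (auto simp: inj_on_def)
  moreover have "(Pow A - {{}}) \<inter> insert a ` Pow A = {}" using assms(2) by auto
  ultimately show ?thesis using assms(1) by (simp add: sum.union_disjoint sum.reindex)
qed

text \<open>Sorts the index sets of a grafted product by whether they meet \<open>A'\<close>; in the
  mixed sum \<open>B\<close> may be empty while \<open>B'\<close> may not.\<close>

lemma sum_Pow_Un:
  assumes "finite A" "finite A'" "A \<inter> A' = {}"
  shows "(\<Sum>B\<in>Pow (A \<union> A') - {{}}. f B) =
    (\<Sum>B\<in>Pow A - {{}}. f B) + (\<Sum>B\<in>Pow A. \<Sum>B'\<in>Pow A' - {{}}. f (B \<union> B'))"
proof -
  let ?P = "Pow A \<times> (Pow A' - {{}})"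
  have "Pow (A \<union> A') - {{}} \<subseteq> (Pow A - {{}}) \<union> (\<lambda>(B, B'). B \<union> B') ` ?P"
  proof
    fix S assume S: "S \<in> Pow (A \<union> A') - {{}}"
    show "S \<in> (Pow A - {{}}) \<union> (\<lambda>(B, B'). B \<union> B') ` ?P"
    proof (cases "S \<subseteq> A")
      case False
      then have "(S \<inter> A, S \<inter> A') \<in> ?P" "S = (S \<inter> A) \<union> (S \<inter> A')" using S by auto
      then show ?thesis by (intro UnI2 image_eqI[of _ _ "(S \<inter> A, S \<inter> A')"]) auto
    qed (use S in auto)
  qed
  then have "Pow (A \<union> A') - {{}} = (Pow A - {{}}) \<union> (\<lambda>(B, B'). B \<union> B') ` ?P" by blast
  moreover have "inj_on (\<lambda>(B, B'). B \<union> B') ?P"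
  proof (rule inj_on_inverseI[where g = "\<lambda>S. (S \<inter> A, S \<inter> A')"])
    fix p assume "p \<in> ?P"
    then show "((case p of (B, B') \<Rightarrow> B \<union> B') \<inter> A, (case p of (B, B') \<Rightarrow> B \<union> B') \<inter> A') = p"
      using assms(3) by (cases p) auto
  qed
  moreover have "(Pow A - {{}}) \<inter> (\<lambda>(B, B'). B \<union> B') ` ?P = {}" using assms(3) by auto
  ultimately show ?thesis using assms(1,2)
    by (simp add: sum.union_disjoint sum.reindex case_prod_unfold sum.cartesian_product)
qed

section \<open>Components, constructs and supports of shuffle products\<close>

lemma component_hypergraph:
  assumes "hypergraph H" "K \<in> components H"
  shows "hypergraph K" "\<Union>K \<noteq> {}"
proof -
  obtain P where P: "decomposition H P" using decomposition_exists assms(1) by auto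
  then obtain X where X: "X \<in> P" "K = induced H X" using assms components_eq by blast
  moreover have "X \<noteq> {}" "X \<subseteq> \<Union>H" using decompositionD(1,3)[OF P] X(1) by blast+
  ultimately show "hypergraph K" "\<Union>K \<noteq> {}"
    using Union_induced[OF assms(1)] hypergraph_induced[OF assms(1)] by auto
qed

lemma component_eqI:
  assumes "hypergraph H" "K \<in> components H" "L \<in> components H" "\<Union>K \<inter> \<Union>L \<noteq> {}"
  shows "K = L"
proof -
  obtain P where P: "decomposition H P" using decomposition_exists assms(1) by auto
  note comp = components_eq[OF assms(1) P]
  obtain X where X: "X \<in> P" "K = induced H X" using assms(2) comp by auto
  obtain Y where Y: "Y \<in> P" "L = induced H Y" using assms(3) comp by auto
  note XY = X Y
  have "X \<subseteq> \<Union>H" "Y \<subseteq> \<Union>H" using decompositionD(1)[OF P] XY by blast+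
  then have "X \<inter> Y \<noteq> {}" using assms(1,4) XY by (simp add: Union_induced)
  then have "X = Y" using decompositionD(2)[OF P] XY by (auto simp: disjoint_def)
  then show ?thesis using XY by simp
qed

lemma Union_components:
  assumes "hypergraph H"
  shows "(\<Union>K\<in>components H. \<Union>K) = \<Union>H"
proof -
  obtain P where P: "decomposition H P" using decomposition_exists assms by auto
  have "\<Union>(induced H X) = X" if "X \<in> P" for X
    using decompositionD(1)[OF P] that by (intro Union_induced[OF assms]) blast
  then have "(\<Union>K\<in>components H. \<Union>K) = \<Union>P" using components_eq[OF assms P] by auto
  then show ?thesis using decompositionD(1)[OF P] by simp
qed

lemma finite_components:
  assumes "hypergraph H"
  shows "finite (components H)"
proof -
  obtain P where P: "decomposition H P" using decomposition_exists assms by auto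
  have "finite (\<Union>H)" using assms unfolding hypergraph_def by blast
  then have "finite (\<Union>P)" by (simp only: decompositionD(1)[OF P])
  then have "finite P" by (rule finite_UnionD)
  then show ?thesis using components_eq[OF assms P] by simp
qed

lemma component_delete_subset:
  assumes "hypergraph H" "K \<in> components (delete H X)"
  shows "\<Union>K \<subseteq> \<Union>H - X"
  using components_Union_subset[OF hypergraph_delete[OF assms(1)] assms(2)]
    Union_delete[OF assms(1)] by simp

text \<open>The union of all node labels recovers the carrier from the tree alone; this is what
  tells subtrees over different components apart.\<close>

primrec labels :: "'v ctree \<Rightarrow> 'v set" where
  "labels (Node Y Ts) = Y \<union> \<Union>(fset (labels |`| Ts))"

lemma labels_construct:
  assumes "is_construct H T" "hypergraph H"
  shows "labels T = \<Union>H"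
  using assms
proof induction
  case (1 Y H T Ts)
  note del = hypergraph_delete[OF "1.prems"]
  have "labels (Node Y Ts) = Y \<union> (\<Union>K\<in>components (delete H Y). labels (T K))"
    using 1 by (simp add: image_image)
  also have "(\<Union>K\<in>components (delete H Y). labels (T K)) = (\<Union>K\<in>components (delete H Y). \<Union>K)"
    using "1.IH" component_hypergraph(1)[OF del] by (intro SUP_cong) auto
  also have "\<dots> = \<Union>H - Y" using Union_components[OF del] Union_delete[OF "1.prems"] by simp
  finally show ?case using 1 by blast
qed

lemma construct_root:
  assumes "is_construct H T"
  shows "root_label T \<noteq> {}" "root_label T \<subseteq> \<Union>H" "\<Union>H \<noteq> {}"
  using assms by (cases; auto)+

lemma construct_subtree:
  assumes "is_construct H T" "K \<in> components (delete H (root_label T))"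
  obtains S where "S |\<in>| subtrees T" "is_construct K S"
  using assms by cases auto

text \<open>Two subtrees that are constructs of the same \<open>K\<close> have the same union of
  labels, so they sit over components with equal nonempty carriers, that is, over the same
  component.\<close>

lemma construct_subtree_unique:
  assumes "is_construct H T" "hypergraph H"
    and "S |\<in>| subtrees T" "is_construct K S" "S' |\<in>| subtrees T" "is_construct K S'"
    and K: "hypergraph K" "\<Union>K \<noteq> {}"
  shows "S = S'"
  using assms(1)
proof cases
  case (1 Y R Ts)
  let ?H = "delete H Y"
  have H: "hypergraph ?H" by (rule hypergraph_delete) fact
  have *: "\<exists>L\<in>components ?H. V = R L \<and> \<Union>L = \<Union>K" if V: "V |\<in>| Ts" "is_construct K V" for V
  proof -
    obtain L where L: "L \<in> components ?H" "V = R L" using V 1(5) by blast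
    have "labels V = \<Union>K" by (rule labels_construct) fact+
    moreover have "labels V = \<Union>L"
      using L 1(4) component_hypergraph[OF H L(1)] labels_construct by blast
    ultimately show ?thesis using L by auto
  qed
  obtain L L' where "L \<in> components ?H" "L' \<in> components ?H" "S = R L" "S' = R L'"
    "\<Union>L = \<Union>K" "\<Union>L' = \<Union>K"
    using * assms(3-6) 1(1) by (metis ctree.sel(2))
  then show ?thesis using component_eqI[OF H, of L L'] K(2) by auto
qed

section \<open>Splitting the constructs of a delegation\<close>

lemma delegationD:
  assumes "delegation (A, H) C"
  shows "hypergraph H" "finite A" "\<And>a. a \<in> A \<Longrightarrow> hypergraph a" "disjoint_family_on Union A"
    "\<Union>H = (\<Union>a\<in>A. \<Union>a)" "\<And>a. a \<in> A \<Longrightarrow> is_construct a (C a)"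
  using assms by (auto simp: delegation_def preteam_def)

lemma member_eqI:
  assumes "disjoint_family_on Union A" "a \<in> A" "b \<in> A" "\<Union>a \<inter> \<Union>b \<noteq> {}"
  shows "a = b"
  using assms unfolding disjoint_family_on_def by blast

text \<open>A component of \<open>b\<close> has a nonempty carrier inside \<open>b\<close>, hence
  differs from every member disjoint from \<open>b\<close>. Since members index themselves, this
  keeps newly created members apart from retained ones.\<close>

lemma component_of_member_notin:
  assumes "disjoint_family_on Union A" "b \<in> A" "b \<notin> M" "M \<subseteq> A" "hypergraph b"
    and "K \<in> components (delete b X)"
  shows "K \<notin> M"
proof
  assume "K \<in> M"
  then have "\<Union>K \<inter> \<Union>b = {}" using assms(1-4) member_eqI by fast
  then show False
    using component_delete_subset[OF assms(5,6)]
      component_hypergraph(2)[OF hypergraph_delete[OF assms(5)] assms(6)] by blast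
qed

text \<open>Disjointness of the carriers makes \<open>a\<close> determine \<open>b\<close>, and then
  uniqueness of subtrees determines \<open>T\<close>, so the definite description evaluates.\<close>

lemma split_constructs_component:
  assumes "delegation (A, H) C" "B \<subseteq> A" "b \<in> B" "a \<in> components (delete b (root_label (C b)))"
    and T: "T |\<in>| subtrees (C b)" "is_construct a T"
  shows "split_constructs A B C a = T"
proof -
  note A = delegationD[OF assms(1)]
  have b: "b \<in> A" "hypergraph b" using assms A by auto
  have a: "hypergraph a" "\<Union>a \<noteq> {}" "\<Union>a \<subseteq> \<Union>b"
    using component_hypergraph[OF hypergraph_delete[OF b(2)] assms(4)]
      component_delete_subset[OF b(2) assms(4)] by auto
  have "a \<notin> A - B"
    by (rule component_of_member_notin[OF A(4) b(1) _ _ b(2) assms(4)]) (use assms(3) in auto)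
  moreover have "(THE T. \<exists>b\<in>B. a \<in> components (delete b (root_label (C b))) \<and>
                        T |\<in>| subtrees (C b) \<and> is_construct a T) = T"
  proof (rule the_equality)
    show "\<exists>b\<in>B. a \<in> components (delete b (root_label (C b))) \<and> T |\<in>| subtrees (C b) \<and> is_construct a T"
      using assms by blast
    fix S assume "\<exists>b\<in>B. a \<in> components (delete b (root_label (C b))) \<and>
      S |\<in>| subtrees (C b) \<and> is_construct a S"
    then obtain b' where b': "b' \<in> B" "a \<in> components (delete b' (root_label (C b')))"
      "S |\<in>| subtrees (C b')" "is_construct a S" by blast
    have "\<Union>a \<subseteq> \<Union>b'" using component_delete_subset[OF _ b'(2)] A b' assms(2) by blast
    moreover have "b' \<in> A" using b' assms(2) by auto
    ultimately have "b' = b" using member_eqI[OF A(4), of b' b] a b by fast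
    then show "S = T"
      using construct_subtree_unique[OF A(6)[OF b(1)] b(2)] a(1,2) b' T by blast
  qed
  ultimately show ?thesis by (simp only: split_constructs_def if_False)
qed

lemma split_constructs_construct:
  assumes "delegation (A, H) C" "B \<subseteq> A" "a \<in> split_members A B (\<lambda>b. root_label (C b))"
  shows "is_construct a (split_constructs A B C a)"
proof (cases "a \<in> A - B")
  case True
  then show ?thesis using delegationD(6)[OF assms(1)] by (simp add: split_constructs_def)
next
  case False
  then obtain b where b: "b \<in> B" "a \<in> components (delete b (root_label (C b)))"
    using assms(3) by (auto simp: split_members_def)
  then obtain T where "T |\<in>| subtrees (C b)" "is_construct a T"
    using construct_subtree[OF delegationD(6)[OF assms(1), of b]] assms(2) by blast
  then show ?thesis using split_constructs_component[OF assms(1,2) b] by simp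
qed

section \<open>Locality and support of the products\<close>

text \<open>One unfolding suffices without induction: for \<open>B \<subseteq> A\<close>,
  \<open>split_constructs\<close> reads only values on \<open>A\<close>, so its two results already
  agree as functions.\<close>

lemma shuffle_part_cong:
  assumes "\<And>a. a \<in> A \<Longrightarrow> C a = C' a"
  shows "shuffle_part q (A, H) B C = shuffle_part q (A, H) B C'"
proof -
  have del: "delegation (A, H) C = delegation (A, H) C'"
    using assms by (simp add: delegation_def)
  show ?thesis
  proof (cases "B \<subseteq> A")
    case True
    have root: "root_label (C b) = root_label (C' b)" if "b \<in> B" for b
      using that True assms by auto
    have "split_constructs A B C a = split_constructs A B C' a" for a
    proof -
      have "(\<exists>b\<in>B. a \<in> components (delete b (root_label (C b))) \<and> T |\<in>| subtrees (C b) \<and> is_construct a T)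
          = (\<exists>b\<in>B. a \<in> components (delete b (root_label (C' b))) \<and> T |\<in>| subtrees (C' b) \<and> is_construct a T)"
        for T using True assms by (intro bex_cong refl) auto
      then show ?thesis unfolding split_constructs_def using assms by simp
    qed
    then have sc: "split_constructs A B C = split_constructs A B C'" by auto
    have st: "subteam A B (\<lambda>b. root_label (C b)) K = subteam A B (\<lambda>b. root_label (C' b)) K" for K
      unfolding subteam_def split_members_def using root by auto
    have "(\<Union>b\<in>B. root_label (C b)) = (\<Union>b\<in>B. root_label (C' b))" using root by auto
    then show ?thesis by (simp only: shuffle_part.simps del sc st)
  qed (simp add: shuffle_part.simps)
qed

lemma shuffle_cong:
  assumes "\<And>a. a \<in> A \<Longrightarrow> C a = C' a"
  shows "shuffle q (A, H) C = shuffle q (A, H) C'"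
  using shuffle_part_cong[OF assms] by (simp add: shuffle.simps)

lemma shuffle_part_lin_put_at:
  assumes "finite A" "a0 \<in> A"
  shows "shuffle_part_lin q (A, H) B (put_at C a0 D) =
    linear_ext (\<lambda>t. shuffle_part q (A, H) B (C(a0 := t))) D"
  unfolding shuffle_part_lin_def fst_conv using assms
  by (rule multilinear_put_at) (rule shuffle_part_cong, simp)

lemma shuffle_lin_put_at:
  assumes "finite A" "a0 \<in> A"
  shows "shuffle_lin q (A, H) (put_at C a0 D) =
    linear_ext (\<lambda>t. shuffle q (A, H) (C(a0 := t))) D"
  unfolding shuffle_lin_def fst_conv using assms
  by (rule multilinear_put_at) (rule shuffle_cong, simp)

lemma construct_NodeI:
  assumes H: "hypergraph H" and "Y \<noteq> {}" "Y \<subseteq> \<Union>H"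
    and "\<And>K. K \<in> components (delete H Y) \<Longrightarrow> is_construct K (T K)"
  shows "is_construct H (Node Y (Abs_fset (T ` components (delete H Y))))"
  using assms(2-4)
  by (rule is_construct.intros)
    (simp_all add: Abs_fset_inverse finite_components hypergraph_delete H)

text \<open>Lets statements about families of constructs be applied to the trees over which
  \<open>linear_ext\<close> sums.\<close>

lemma keys_shuffle_construct:
  "t \<in> keys (shuffle q \<tau> C) \<Longrightarrow> is_construct (snd \<tau>) t"
  "t \<in> keys (shuffle_part q \<tau> B C) \<Longrightarrow> is_construct (snd \<tau>) t"
proof (induction q \<tau> C and q \<tau> B C arbitrary: t and t rule: shuffle_shuffle_part.induct)
  case (1 q A H C)
  have "(\<Sum>B\<in>Pow A - {{}}. q ^ (card B - 1) * lookup (shuffle_part q (A, H) B C) t) \<noteq> 0"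
    using 1(2) by (simp add: in_keys_iff shuffle.simps lookup_sum)
  then obtain B where "B \<in> Pow A - {{}}" "q ^ (card B - 1) * lookup (shuffle_part q (A, H) B C) t \<noteq> 0"
    by (meson sum.not_neutral_contains_not_neutral)
  then show ?case using 1(1)[of B t] by (simp add: in_keys_iff)
next
  case (2 q A H B C)
  let ?Y = "\<Union>b\<in>B. root_label (C b)"
  \<comment> \<open>When the guard of the recursion fails, \<open>shuffle_part\<close> takes the
    default value \<open>0\<close>, whose support is empty.\<close>
  have *: "delegation (A, H) C \<and> B \<noteq> {} \<and> B \<subseteq> A"
  proof (rule ccontr)
    assume "\<not> ?thesis"
    then have "shuffle_part q (A, H) B C = 0" by (simp only: shuffle_part.simps if_False)
    then show False using 2(2) by simp
  qed
  note A = delegationD[OF conjunct1[OF *]]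
  have "t \<in> keys (node_lin ?Y (components (delete H ?Y))
      (\<lambda>K. shuffle q (subteam A B (\<lambda>b. root_label (C b)) K) (split_constructs A B C)))"
    using 2(2) by (simp only: shuffle_part.simps * if_True simp_thms)
  then obtain T where T: "T \<in> (\<Pi>\<^sub>E K\<in>components (delete H ?Y).
      keys (shuffle q (subteam A B (\<lambda>b. root_label (C b)) K) (split_constructs A B C)))"
    "t = Node ?Y (Abs_fset (T ` components (delete H ?Y)))"
    unfolding node_lin_def by (rule keys_multilinear) simp
  show ?case
    unfolding T(2) snd_conv
  proof (rule construct_NodeI[OF A(1)])
    have root: "root_label (C b) \<noteq> {}" "root_label (C b) \<subseteq> \<Union>b" "b \<in> A" if "b \<in> B" for b
    proof -
      show "b \<in> A" using * that by blast
      then show "root_label (C b) \<noteq> {}" "root_label (C b) \<subseteq> \<Union>b"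
        using construct_root[OF A(6)] by blast+
    qed
    obtain b where "b \<in> B" using * by blast
    then show "?Y \<noteq> {}" using root(1)[of b] by blast
    have "\<Union>b \<subseteq> \<Union>H" if "b \<in> B" for b
      using UN_upper[OF root(3)[OF that], of Union] by (simp only: A(5))
    then show "?Y \<subseteq> \<Union>H" by (intro UN_least order_trans[OF root(2)])
    fix K assume K: "K \<in> components (delete H ?Y)"
    have "is_construct (snd (subteam A B (\<lambda>b. root_label (C b)) K)) (T K)"
      by (rule 2(1)[OF * K PiE_mem[OF T(1) K]])
    then show "is_construct K (T K)" by (simp add: subteam_def)
  qed
qed

text \<open>The construct on a component of \<open>b\<close> is a subtree of the tree at
  \<open>b\<close> alone, so the rest of the delegation has no influence on it.\<close>

lemma split_constructs_eq:
  assumes "delegation (A, H) C" "B \<subseteq> A" "b \<in> B" and "delegation (A2, H2) C2" "B2 \<subseteq> A2" "b \<in> B2"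
    and "C b = C2 b" "a \<in> components (delete b (root_label (C b)))"
  shows "split_constructs A B C a = split_constructs A2 B2 C2 a"
proof -
  have "is_construct b (C b)" using assms(2,3) by (intro delegationD(6)[OF assms(1)]) auto
  then obtain S where S: "S |\<in>| subtrees (C b)" "is_construct a S"
    using construct_subtree assms(8) by blast
  have "split_constructs A B C a = S"
    by (rule split_constructs_component[OF assms(1-3,8) S])
  moreover have "split_constructs A2 B2 C2 a = S"
    using split_constructs_component[OF assms(4-6)] S assms(7,8) by simp
  ultimately show ?thesis by simp
qed

lemma split_constructs_keep: "a \<in> A - B \<Longrightarrow> split_constructs A B C a = C a"
  by (simp add: split_constructs_def)

text \<open>For fixed \<open>B\<close>, linearity assembles the mixed parts over all
  \<open>B'\<close> into the total product in the entry at \<open>a0\<close>; what remains is the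
  sum over all nonempty subsets of \<open>A\<close>, sorted by whether they contain
  \<open>a0\<close>.\<close>

lemma shuffle_graft_of_parts:
  assumes "finite A" "a0 \<in> A" "finite A'" "(A - {a0}) \<inter> A' = {}"
    and outside: "\<And>B. B \<noteq> {} \<Longrightarrow> B \<subseteq> A - {a0} \<Longrightarrow> shuffle_part q (graft A a0 A', H) B C =
      shuffle_part_lin q (A, H) B (put_at C a0 (shuffle q (A', a0) C))"
    and inside: "\<And>B B'. B \<subseteq> A - {a0} \<Longrightarrow> B' \<noteq> {} \<Longrightarrow> B' \<subseteq> A' \<Longrightarrow>
      shuffle_part q (graft A a0 A', H) (B \<union> B') C =
      shuffle_part_lin q (A, H) (insert a0 B) (put_at C a0 (shuffle_part q (A', a0) B' C))"
  shows "shuffle q (graft A a0 A', H) C =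
    linear_ext (\<lambda>t. shuffle q (A, H) (C(a0 := t))) (shuffle q (A', a0) C)"
proof -
  let ?A = "A - {a0}"
  define f where "f B = linear_ext (\<lambda>t. shuffle_part q (A, H) B (C(a0 := t)))" for B
  have f: "shuffle_part_lin q (A, H) B (put_at C a0 D) = f B D" for B D
    unfolding f_def by (rule shuffle_part_lin_put_at[OF assms(1,2)])
  let ?D = "shuffle q (A', a0) C"
  have fin: "finite ?A" using assms(1) by simp
  have mixed: "(\<Sum>B'\<in>Pow A' - {{}}. scale (q ^ (card (B \<union> B') - 1))
        (shuffle_part q (graft A a0 A', H) (B \<union> B') C)) =
      scale (q ^ (card (insert a0 B) - 1)) (f (insert a0 B) ?D)" if B: "B \<in> Pow ?A" for B
  proof -
    have "scale (q ^ (card (B \<union> B') - 1)) (shuffle_part q (graft A a0 A', H) (B \<union> B') C) =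
        scale (q ^ card B) (scale (q ^ (card B' - 1)) (f (insert a0 B) (shuffle_part q (A', a0) B' C)))"
      if B': "B' \<in> Pow A' - {{}}" for B'
    proof -
      have finB: "finite B" "finite B'" using B B' assms(3) fin finite_subset by auto
      have "B \<inter> B' = {}" using B B' assms(4) by auto
      then have "card (B \<union> B') = card B + card B'" using finB by (simp add: card_Un_disjoint)
      \<comment> \<open>This makes the truncated subtraction in the exponent harmless, even when
        \<open>B\<close> is empty.\<close>
      moreover have "card B' > 0" using B' finB by (auto simp: card_gt_0_iff)
      ultimately have "card (B \<union> B') - 1 = card B + (card B' - 1)" by simp
      moreover have "shuffle_part q (graft A a0 A', H) (B \<union> B') C =
          f (insert a0 B) (shuffle_part q (A', a0) B' C)"
        using inside[of B B'] B B' by (simp add: f)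
      ultimately show ?thesis by (simp add: power_add)
    qed
    then have "(\<Sum>B'\<in>Pow A' - {{}}. scale (q ^ (card (B \<union> B') - 1))
          (shuffle_part q (graft A a0 A', H) (B \<union> B') C)) =
        scale (q ^ card B) (\<Sum>B'\<in>Pow A' - {{}}.
          scale (q ^ (card B' - 1)) (f (insert a0 B) (shuffle_part q (A', a0) B' C)))"
      by (simp add: lin.scale_sum_right)
    also have "\<dots> = scale (q ^ card B) (f (insert a0 B) ?D)"
      by (simp add: f_def shuffle.simps linear_ext_sum linear_ext_scale)
    moreover have "card (insert a0 B) - 1 = card B"
    proof -
      have "finite B" "a0 \<notin> B" using B fin finite_subset by auto
      then show ?thesis by simp
    qed
    ultimately show ?thesis by simp
  qed
  have "shuffle q (graft A a0 A', H) C =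
      (\<Sum>B\<in>Pow ?A - {{}}. scale (q ^ (card B - 1)) (shuffle_part q (graft A a0 A', H) B C)) +
      (\<Sum>B\<in>Pow ?A. \<Sum>B'\<in>Pow A' - {{}}. scale (q ^ (card (B \<union> B') - 1))
        (shuffle_part q (graft A a0 A', H) (B \<union> B') C))"
    unfolding shuffle.simps unfolding graft_def by (rule sum_Pow_Un[OF fin assms(3,4)])
  also have "\<dots> = (\<Sum>B\<in>Pow ?A - {{}}. scale (q ^ (card B - 1)) (f B ?D)) +
      (\<Sum>B\<in>Pow ?A. scale (q ^ (card (insert a0 B) - 1)) (f (insert a0 B) ?D))"
    using mixed outside by (intro arg_cong2[of _ _ _ _ "(+)"] sum.cong refl) (auto simp: f)
  also have "\<dots> = (\<Sum>B\<in>Pow (insert a0 ?A) - {{}}. scale (q ^ (card B - 1)) (f B ?D))"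
    using fin by (intro sum_Pow_insert[symmetric]) auto
  also have "\<dots> = linear_ext (\<lambda>t. shuffle q (A, H) (C(a0 := t))) ?D"
    unfolding insert_Diff[OF assms(2)]
    by (simp add: f_def shuffle.simps[of q A H] linear_ext_sum_left linear_ext_scale_left)
  finally show ?thesis .
qed

section \<open>Teams of an associative strict clan\<close>

locale assoc_clan =
  fixes U :: "'v hgraph set" and \<Xi> :: "'v team set"
  assumes universe: "is_universe U" and strict: "strict_clan U \<Xi>" and assoc: "associative_clan \<Xi>"
begin

lemma team_preteam: "(A, H) \<in> \<Xi> \<Longrightarrow> preteam U (A, H)"
  using strict unfolding strict_clan_def strict_team_def by fastforce

lemma teamD:
  assumes "(A, H) \<in> \<Xi>"
  shows "hypergraph H" "finite A" "\<And>a. a \<in> A \<Longrightarrow> hypergraph a" "disjoint_family_on Union A"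
    "\<Union>H = (\<Union>a\<in>A. \<Union>a)"
  using team_preteam[OF assms] universe unfolding preteam_def is_universe_def by auto

lemma team_member_subset: "(A, H) \<in> \<Xi> \<Longrightarrow> a \<in> A \<Longrightarrow> \<Union>a \<subseteq> \<Union>H"
  using teamD(5) by (metis UN_upper)

lemma team_delegation:
  assumes "(A, H) \<in> \<Xi>" "\<And>a. a \<in> A \<Longrightarrow> is_construct a (C a)"
  shows "delegation (A, H) C"
proof -
  have "U \<subseteq> {K. hypergraph K \<and> hconnected K}" using universe by (auto simp: is_universe_def)
  then show ?thesis
    using team_preteam[OF assms(1)] assms(2) unfolding delegation_def preteam_def by auto
qed

lemma graft_team: "(A, H) \<in> \<Xi> \<Longrightarrow> a0 \<in> A \<Longrightarrow> (A', a0) \<in> \<Xi> \<Longrightarrow> (graft A a0 A', H) \<in> \<Xi>"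
  using assoc unfolding associative_clan_def by blast

lemma split_in_component:
  assumes "(A, H) \<in> \<Xi>" "choice A B X" "a \<in> split_members A B X"
  obtains K where "K \<in> components (delete H (\<Union>b\<in>B. X b))" "\<Union>a \<subseteq> \<Union>K"
proof -
  have "strict_team U (A, H)" using strict assms(1) unfolding strict_clan_def by blast
  then have "\<forall>B X. choice A B X \<longrightarrow> (\<forall>a \<in> split_members A B X.
      a \<in> U \<and> (\<exists>K \<in> components (delete H (\<Union>b\<in>B. X b)). \<Union>a \<subseteq> \<Union>K))"
    unfolding strict_team_def prod.case by (rule conjunct2)
  then show ?thesis using assms(2,3) that by blast
qed

lemma subteam_team:
  assumes "(A, H) \<in> \<Xi>" "choice A B X" "K \<in> components (delete H (\<Union>b\<in>B. X b))"
  shows "({a \<in> split_members A B X. \<Union>a \<subseteq> \<Union>K}, K) \<in> \<Xi>"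
  using assms strict unfolding strict_clan_def subteam_def by blast

section \<open>Nonempty members and shrinking carriers\<close>

text \<open>Choosing every nonempty member with its whole carrier deletes all of \<open>H\<close>
  and leaves no component. An empty member would survive this choice, and strictness would place it
  in a component that does not exist.\<close>

lemma member_nonempty:
  assumes "(A, H) \<in> \<Xi>" "\<Union>H \<noteq> {}" "a \<in> A"
  shows "\<Union>a \<noteq> {}"
proof
  assume empty: "\<Union>a = {}"
  note A = teamD[OF assms(1)]
  let ?B = "{b \<in> A. \<Union>b \<noteq> {}}"
  have "(\<Union>b\<in>?B. \<Union>b) = (\<Union>a\<in>A. \<Union>a)" by blast
  then have UB: "(\<Union>b\<in>?B. \<Union>b) = \<Union>H" by (simp only: A(5))
  have "?B \<noteq> {}" using assms(2) unfolding UB[symmetric] by blast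
  then have "choice A ?B Union" by (auto simp: choice_def)
  moreover have "a \<in> split_members A ?B Union" using assms(3) empty by (simp add: split_members_def)
  ultimately obtain K where "K \<in> components (delete H (\<Union>b\<in>?B. \<Union>b))"
    using split_in_component[OF assms(1)] by blast
  then have K: "K \<in> components (delete H (\<Union>H))" by (simp only: UB)
  then show False
    using component_delete_subset[OF A(1) K] component_hypergraph(2)[OF hypergraph_delete[OF A(1)] K]
    by blast
qed

lemma finite_split_members:
  assumes "(A, H) \<in> \<Xi>" "choice A B X"
  shows "finite (split_members A B X)"
proof -
  have "B \<subseteq> A" using assms(2) by (simp add: choice_def)
  then have "finite B" "\<And>b. b \<in> B \<Longrightarrow> hypergraph b"
    using teamD[OF assms(1)] finite_subset by auto
  then show ?thesis
    using teamD(2)[OF assms(1)] unfolding split_members_def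
    by (simp add: finite_components hypergraph_delete)
qed

text \<open>A split member belongs to the subteam on the component containing it, which is again a
  team on a nonempty carrier.\<close>

lemma split_member_nonempty:
  assumes "(A, H) \<in> \<Xi>" "choice A B X" "a \<in> split_members A B X"
  shows "\<Union>a \<noteq> {}"
proof -
  obtain K where K: "K \<in> components (delete H (\<Union>b\<in>B. X b))" "\<Union>a \<subseteq> \<Union>K"
    using split_in_component[OF assms] .
  have "\<Union>K \<noteq> {}"
    by (rule component_hypergraph(2)[OF hypergraph_delete K(1)]) (rule teamD(1)[OF assms(1)])
  then show ?thesis
    using member_nonempty[OF subteam_team[OF assms(1,2) K(1)]] assms(3) K(2) by blast
qed

lemma component_card:
  assumes "(A, H) \<in> \<Xi>" "choice A B X" "K \<in> components (delete H (\<Union>b\<in>B. X b))"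
  shows "card (\<Union>K) < card (\<Union>H)"
proof -
  note A = teamD[OF assms(1)]
  have ch: "B \<noteq> {}" "B \<subseteq> A" "\<forall>b\<in>B. X b \<noteq> {} \<and> X b \<subseteq> \<Union>b"
    using assms(2) unfolding choice_def by simp_all
  then obtain b where b: "b \<in> B" by auto
  then obtain x where x: "x \<in> X b" using ch(3) by auto
  have "X b \<subseteq> \<Union>H"
    using team_member_subset[OF assms(1) subsetD[OF ch(2) b]] bspec[OF ch(3) b] by (meson order_trans)
  then have "x \<in> \<Union>H" using x by (rule subsetD)
  moreover have "x \<in> (\<Union>b\<in>B. X b)" using b x by (rule UN_I)
  moreover note component_delete_subset[OF A(1) assms(3)]
  ultimately have "\<Union>K \<subset> \<Union>H" by (metis DiffD2 DiffE psubsetI subset_eq)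
  moreover have "finite (\<Union>H)" using A(1) unfolding hypergraph_def by blast
  ultimately show ?thesis by (rule psubset_card_mono[rotated])
qed

section \<open>Simultaneous grafts\<close>

lemma multi_graft_notin:
  assumes A: "(A, K) \<in> \<Xi>" "\<Union>K \<noteq> {}" and "L0 \<in> A" "L \<in> A" "L \<noteq> L0" "(N, L) \<in> \<Xi>"
  shows "L0 \<notin> N"
proof
  assume "L0 \<in> N"
  then have "\<Union>L0 \<subseteq> \<Union>L" using team_member_subset assms(6) by blast
  moreover have "\<Union>L0 \<noteq> {}" using member_nonempty[OF A assms(3)] .
  ultimately have "L0 = L" using member_eqI[OF teamD(4)[OF A(1)] assms(3,4)] by blast
  then show False using assms(5) by simp
qed

text \<open>Removing \<open>L0\<close> from the partly grafted team must not remove a member of some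
  \<open>N L\<close> grafted earlier. With members as their own indices this has to be excluded
  explicitly.\<close>

lemma graft_multi_graft:
  assumes "(A, K) \<in> \<Xi>" "\<Union>K \<noteq> {}" "insert L0 I \<subseteq> A" "L0 \<notin> I" "\<And>L. L \<in> I \<Longrightarrow> (N L, L) \<in> \<Xi>"
  shows "graft ((A - I) \<union> (\<Union>L\<in>I. N L)) L0 (N L0) = (A - insert L0 I) \<union> (\<Union>L\<in>insert L0 I. N L)"
proof -
  have "L0 \<notin> N L" if "L \<in> I" for L
    using assms that by (intro multi_graft_notin[OF assms(1,2), of _ L]) auto
  then show ?thesis by (auto simp: graft_def)
qed

lemma multi_graft_team:
  assumes A: "(A, K) \<in> \<Xi>" "\<Union>K \<noteq> {}"
    and "finite I" "I \<subseteq> A" "\<And>L. L \<in> I \<Longrightarrow> (N L, L) \<in> \<Xi>"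
  shows "((A - I) \<union> (\<Union>L\<in>I. N L), K) \<in> \<Xi>"
  using assms(3-5)
proof (induction I rule: finite_induct)
  case empty
  then show ?case using A by simp
next
  case (insert L0 I)
  then have "(graft ((A - I) \<union> (\<Union>L\<in>I. N L)) L0 (N L0), K) \<in> \<Xi>"
    by (intro graft_team) auto
  then show ?case using graft_multi_graft[OF A, of L0 I N] insert by simp
qed

text \<open>The induction statement. It ranges over all teams on \<open>K\<close> and all grafts to
  them, because one step of the recursion changes both.\<close>

definition shuffle_assoc_at :: "real \<Rightarrow> 'v hgraph \<Rightarrow> bool" where
  "shuffle_assoc_at q K \<longleftrightarrow> (\<forall>A a0 A' C. (A, K) \<in> \<Xi> \<longrightarrow> a0 \<in> A \<longrightarrow> (A', a0) \<in> \<Xi> \<longrightarrow>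
     (\<forall>a\<in>graft A a0 A'. is_construct a (C a)) \<longrightarrow>
     shuffle q (graft A a0 A', K) C =
     linear_ext (\<lambda>t. shuffle q (A, K) (C(a0 := t))) (shuffle q (A', a0) C))"

text \<open>Grafts at different members do not interfere: \<open>L0\<close> lies outside every other
  \<open>N L\<close>, so changing the construct at \<open>L0\<close> leaves the products over the
  \<open>N L\<close> unchanged, and the nested linear extensions combine into a multilinear
  one.\<close>

lemma shuffle_multi_graft:
  assumes single: "shuffle_assoc_at q K"
    and A: "(A, K) \<in> \<Xi>" "\<Union>K \<noteq> {}"
    and "finite I" "I \<subseteq> A" "\<And>L. L \<in> I \<Longrightarrow> (N L, L) \<in> \<Xi>"
    and "\<And>a. a \<in> (A - I) \<union> (\<Union>L\<in>I. N L) \<Longrightarrow> is_construct a (E a)"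
  shows "shuffle q ((A - I) \<union> (\<Union>L\<in>I. N L), K) E =
    multilinear I (\<lambda>T. shuffle q (A, K) (\<lambda>a. if a \<in> I then T a else E a))
      (\<lambda>L. shuffle q (N L, L) E)"
  using assms(4-7)
proof (induction I arbitrary: E rule: finite_induct)
  case empty
  then show ?case using A by (simp add: multilinear_def)
next
  case (insert L0 I)
  let ?A1 = "(A - I) \<union> (\<Union>L\<in>I. N L)"
  have L0: "L0 \<in> A" "L0 \<notin> I" and N0: "(N L0, L0) \<in> \<Xi>" using insert by auto
  have L0_notin: "L0 \<notin> N L" if "L \<in> I" for L
    using insert.prems(1,2) insert.hyps(2) that by (intro multi_graft_notin[OF A, of _ L]) auto
  have graft_eq: "graft ?A1 L0 (N L0) = (A - insert L0 I) \<union> (\<Union>L\<in>insert L0 I. N L)"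
    using insert.prems insert.hyps by (intro graft_multi_graft[OF A]) auto
  \<comment> \<open>Here \<open>L0\<close> is still an ordinary member of the partly grafted team
    and carries the basis construct \<open>t\<close>.\<close>
  have step: "shuffle q (?A1, K) (E(L0 := t)) =
      multilinear I (\<lambda>T. shuffle q (A, K) (\<lambda>a. if a \<in> I then T a else (E(L0 := t)) a))
        (\<lambda>L. shuffle q (N L, L) (E(L0 := t)))" if "is_construct L0 t" for t
    using insert.prems that by (intro insert.IH) auto
  have A1: "(?A1, K) \<in> \<Xi>" using insert by (intro multi_graft_team[OF A]) auto
  have "shuffle q (graft ?A1 L0 (N L0), K) E =
      linear_ext (\<lambda>t. shuffle q (?A1, K) (E(L0 := t))) (shuffle q (N L0, L0) E)"
    using single[unfolded shuffle_assoc_at_def, rule_format, OF A1 _ N0] insert.prems(3) L0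
    by (simp add: graft_eq)
  also have "\<dots> = linear_ext (\<lambda>t. multilinear I
      (\<lambda>T. shuffle q (A, K) (\<lambda>a. if a \<in> insert L0 I then (T(L0 := t)) a else E a))
      (\<lambda>L. shuffle q (N L, L) E)) (shuffle q (N L0, L0) E)"
  proof (rule linear_ext_cong)
    fix t assume "t \<in> keys (shuffle q (N L0, L0) E)"
    then have t: "is_construct L0 t" using keys_shuffle_construct(1) by fastforce
    have "shuffle q (N L, L) (E(L0 := t)) = shuffle q (N L, L) E" if "L \<in> I" for L
      using L0_notin[OF that] by (intro shuffle_cong) auto
    moreover have "(\<lambda>a. if a \<in> I then T a else (E(L0 := t)) a) =
        (\<lambda>a. if a \<in> insert L0 I then (T(L0 := t)) a else E a)" for T
      using L0(2) by auto
    ultimately show "shuffle q (?A1, K) (E(L0 := t)) = multilinear I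
      (\<lambda>T. shuffle q (A, K) (\<lambda>a. if a \<in> insert L0 I then (T(L0 := t)) a else E a))
      (\<lambda>L. shuffle q (N L, L) E)"
      unfolding step[OF t] by (intro multilinear_cong) auto
  qed
  also have "\<dots> = multilinear (insert L0 I)
      (\<lambda>T. shuffle q (A, K) (\<lambda>a. if a \<in> insert L0 I then T a else E a)) (\<lambda>L. shuffle q (N L, L) E)"
    using insert.hyps by (rule multilinear_insert[symmetric])
  finally show ?case unfolding graft_eq .
qed

text \<open>\<open>J\<close> are the members at which teams \<open>N\<close> get grafted after one step of the recursion, and \<open>g\<close> builds
  the construct of \<open>a0\<close> from constructs of the members in \<open>J\<close>: with \<open>J = {a0}\<close> and \<open>g\<close> the evaluation at
  \<open>a0\<close> this yields the first case of the polydendriform equation, with \<open>J\<close> the components of \<open>a0\<close>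
  minus a root label and \<open>g\<close> the formation of a node it yields the second.\<close>

lemma shuffle_part_lin_graft:
  fixes q :: real
  assumes single: "\<And>K. card (\<Union>K) < card (\<Union>H) \<Longrightarrow> shuffle_assoc_at q K"
    and A: "(A, H) \<in> \<Xi>" "a0 \<in> A" and C: "\<And>a. a \<in> A - {a0} \<Longrightarrow> is_construct a (C a)"
    and X: "choice A B X" "\<And>b. b \<in> B \<Longrightarrow> b \<noteq> a0 \<Longrightarrow> root_label (C b) = X b"
    and g: "\<And>T. T \<in> (\<Pi>\<^sub>E L\<in>J. keys (F L)) \<Longrightarrow> is_construct a0 (g T)"
      "\<And>T. T \<in> (\<Pi>\<^sub>E L\<in>J. keys (F L)) \<Longrightarrow> a0 \<in> B \<Longrightarrow> root_label (g T) = X a0"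
    and J: "J \<subseteq> split_members A B X"
    and sc: "\<And>T a. T \<in> (\<Pi>\<^sub>E L\<in>J. keys (F L)) \<Longrightarrow> a \<in> split_members A B X \<Longrightarrow>
      split_constructs A B (C(a0 := g T)) a = (if a \<in> J then T a else E a)"
    and N: "\<And>L. L \<in> J \<Longrightarrow> (N L, L) \<in> \<Xi>" "\<And>L. L \<in> J \<Longrightarrow> F L = shuffle q (N L, L) E"
    and M: "M = (split_members A B X - J) \<union> (\<Union>L\<in>J. N L)"
    and E: "\<And>a. a \<in> M \<Longrightarrow> is_construct a (E a)"
  shows "shuffle_part_lin q (A, H) B
      (put_at C a0 (multilinear J (\<lambda>T. Poly_Mapping.single (g T) 1) F)) =
    node_lin (\<Union>b\<in>B. X b) (components (delete H (\<Union>b\<in>B. X b)))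
      (\<lambda>K. shuffle q ({a \<in> M. \<Union>a \<subseteq> \<Union>K}, K) E)"
proof -
  let ?Y = "\<Union>b\<in>B. X b"
  let ?Ks = "components (delete H ?Y)"
  let ?S = "split_members A B X"
  let ?M = "\<lambda>K. {a \<in> ?S. \<Union>a \<subseteq> \<Union>K}"
  let ?J = "\<lambda>K. {L \<in> J. \<Union>L \<subseteq> \<Union>K}"
  note H = teamD(1)[OF A(1)]
  note HY = hypergraph_delete[OF H, of ?Y]
  have BA: "B \<noteq> {}" "B \<subseteq> A" using X(1) by (auto simp: choice_def)
  have finA: "finite A" by (rule teamD(2)[OF A(1)])
  have finJ: "finite J" using finite_split_members[OF A(1) X(1)] J finite_subset by blast
  have nonempty: "\<Union>a \<noteq> {}" if "a \<in> ?S" for a by (rule split_member_nonempty[OF A(1) X(1) that])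
  have unique: "K = K'" if "K \<in> ?Ks" "K' \<in> ?Ks" "\<Union>a \<subseteq> \<Union>K" "\<Union>a \<subseteq> \<Union>K'" "\<Union>a \<noteq> {}" for a K K'
    using component_eqI[OF HY that(1,2)] that(3-5) by blast
  have in_comp: "\<exists>K\<in>?Ks. \<Union>a \<subseteq> \<Union>K" if "a \<in> ?S" for a
    by (rule split_in_component[OF A(1) X(1) that]) (rule bexI)
  have JU: "(\<Union>K\<in>?Ks. ?J K) = J"
  proof
    show "(\<Union>K\<in>?Ks. ?J K) \<subseteq> J" by (intro UN_least) simp
    show "J \<subseteq> (\<Union>K\<in>?Ks. ?J K)"
    proof
      fix L assume L: "L \<in> J"
      then obtain K where "K \<in> ?Ks" "\<Union>L \<subseteq> \<Union>K" using in_comp J by (meson subsetD)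
      then show "L \<in> (\<Union>K\<in>?Ks. ?J K)" using L by (intro UN_I[of K]) simp_all
    qed
  qed
  have disj: "disjoint_family_on ?J ?Ks"
    unfolding disjoint_family_on_def
  proof (intro ballI impI equals0I)
    fix K K' L assume "K \<in> ?Ks" "K' \<in> ?Ks" "K \<noteq> K'" "L \<in> ?J K \<inter> ?J K'"
    then show False using unique[of K K' L] nonempty[OF subsetD[OF J, of L]] by simp
  qed
  \<comment> \<open>A member \<open>a\<close> of \<open>N L\<close> follows \<open>L\<close> into
    its component: \<open>a\<close> is nonempty because it carries a construct, and it lies inside
    \<open>L\<close>, which lies inside a single component.\<close>
  have MK: "{a \<in> M. \<Union>a \<subseteq> \<Union>K} = (?M K - ?J K) \<union> (\<Union>L\<in>?J K. N L)" if K: "K \<in> ?Ks" for K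
  proof -
    have "\<Union>a \<subseteq> \<Union>K \<longleftrightarrow> \<Union>L \<subseteq> \<Union>K" if a: "L \<in> J" "a \<in> N L" for a L
    proof
      have aL: "\<Union>a \<subseteq> \<Union>L" by (rule team_member_subset[OF N(1)]) (rule a)+
      then show "\<Union>L \<subseteq> \<Union>K \<Longrightarrow> \<Union>a \<subseteq> \<Union>K" by (rule order_trans)
      assume aK: "\<Union>a \<subseteq> \<Union>K"
      obtain K' where K': "K' \<in> ?Ks" "\<Union>L \<subseteq> \<Union>K'" using in_comp J a(1) by (meson subsetD)
      have "a \<in> M" unfolding M using a by auto
      then have "\<Union>a \<noteq> {}" by (rule construct_root(3)[OF E])
      then have "K = K'" by (rule unique[OF K K'(1) aK order_trans[OF aL K'(2)]])
      then show "\<Union>L \<subseteq> \<Union>K" using K' by simp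
    qed
    then have "{a \<in> (\<Union>L\<in>J. N L). \<Union>a \<subseteq> \<Union>K} = (\<Union>L\<in>?J K. N L)"
      unfolding set_eq_iff UN_iff mem_Collect_eq Bex_def by metis
    moreover have "{a \<in> M. \<Union>a \<subseteq> \<Union>K} =
        {a \<in> ?S - J. \<Union>a \<subseteq> \<Union>K} \<union> {a \<in> (\<Union>L\<in>J. N L). \<Union>a \<subseteq> \<Union>K}"
      unfolding M by (simp only: Un_iff Collect_disj_eq conj_disj_distribR)
    moreover have "{a \<in> ?S - J. \<Union>a \<subseteq> \<Union>K} = ?M K - ?J K"
      by (rule set_eqI) (simp only: Diff_iff mem_Collect_eq, argo)
    ultimately show ?thesis by simp
  qed
  have shuffle_K: "shuffle q ({a \<in> M. \<Union>a \<subseteq> \<Union>K}, K) E =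
      multilinear (?J K) (\<lambda>T. shuffle q (?M K, K) (\<lambda>a. if a \<in> ?J K then T a else E a)) F"
    if K: "K \<in> ?Ks" for K
  proof -
    have "shuffle q ((?M K - ?J K) \<union> (\<Union>L\<in>?J K. N L), K) E =
      multilinear (?J K) (\<lambda>T. shuffle q (?M K, K) (\<lambda>a. if a \<in> ?J K then T a else E a))
        (\<lambda>L. shuffle q (N L, L) E)"
    proof (rule shuffle_multi_graft)
      show "(?M K, K) \<in> \<Xi>" by (rule subteam_team[OF A(1) X(1) K])
      show "\<Union>K \<noteq> {}" by (rule component_hypergraph(2)[OF HY K])
      show "finite (?J K)" "?J K \<subseteq> ?M K" using finJ J by auto
      show "(N L, L) \<in> \<Xi>" if "L \<in> ?J K" for L using N(1) that by blast
      show "is_construct a (E a)" if "a \<in> (?M K - ?J K) \<union> (\<Union>L\<in>?J K. N L)" for a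
      proof (rule E)
        show "a \<in> M" using that unfolding MK[OF K, symmetric] by simp
      qed
    qed (rule single[OF component_card[OF A(1) X(1) K]])
    also have "\<dots> = multilinear (?J K)
        (\<lambda>T. shuffle q (?M K, K) (\<lambda>a. if a \<in> ?J K then T a else E a)) F"
      using N(2) by (intro multilinear_cong) auto
    finally show ?thesis unfolding MK[OF K] .
  qed
  \<comment> \<open>The root labels \<open>X\<close> do not depend on \<open>T\<close>, so all trees
    \<open>g T\<close> lead to the same root, the same components and the same split members; only
    the constructs at \<open>J\<close> vary.\<close>
  have part: "shuffle_part q (A, H) B (C(a0 := g T)) =
      node_lin ?Y ?Ks (\<lambda>K. shuffle q (?M K, K) (\<lambda>a. if a \<in> J then T a else E a))"
    if T: "T \<in> (\<Pi>\<^sub>E L\<in>J. keys (F L))" for T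
  proof -
    let ?C = "C(a0 := g T)"
    have "is_construct a (?C a)" if "a \<in> A" for a using g(1)[OF T] C that by auto
    then have del: "delegation (A, H) ?C" by (rule team_delegation[OF A(1)])
    have root: "root_label (?C b) = X b" if "b \<in> B" for b using g(2)[OF T] X(2) that by auto
    have Y: "(\<Union>b\<in>B. root_label (?C b)) = ?Y" using root by (intro SUP_cong) auto
    have S: "split_members A B (\<lambda>b. root_label (?C b)) = ?S"
      unfolding split_members_def using root by simp
    have "shuffle_part q (A, H) B ?C =
        node_lin ?Y ?Ks (\<lambda>K. shuffle q (?M K, K) (split_constructs A B ?C))"
      using BA del by (subst shuffle_part.simps) (simp only: Y subteam_def S simp_thms if_True)
    also have "\<dots> = node_lin ?Y ?Ks (\<lambda>K. shuffle q (?M K, K) (\<lambda>a. if a \<in> J then T a else E a))"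
      using sc[OF T] by (intro node_lin_cong shuffle_cong refl) blast
    finally show ?thesis .
  qed
  have "shuffle_part_lin q (A, H) B
      (put_at C a0 (multilinear J (\<lambda>T. Poly_Mapping.single (g T) 1) F)) =
      multilinear J (\<lambda>T. shuffle_part q (A, H) B (C(a0 := g T))) F"
    unfolding shuffle_part_lin_put_at[OF finA A(2)] linear_ext_multilinear by simp
  also have "\<dots> = multilinear J
      (\<lambda>T. node_lin ?Y ?Ks (\<lambda>K. shuffle q (?M K, K) (\<lambda>a. if a \<in> J then T a else E a))) F"
    by (intro multilinear_fun_cong part)
  \<comment> \<open>Each member of \<open>J\<close> lies in exactly one component, and the subtree
    over \<open>K\<close> reads \<open>T\<close> only on the part of \<open>J\<close> inside
    \<open>K\<close>. Grouping the variables accordingly moves the extension from the whole node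
    into its separate subtrees.\<close>
  also have "\<dots> = multilinear (\<Union>K\<in>?Ks. ?J K) (\<lambda>T. node_lin ?Y ?Ks
      (\<lambda>K. shuffle q (?M K, K) (\<lambda>a. if a \<in> ?J K then restrict T (?J K) a else E a))) F"
    unfolding JU by (intro multilinear_fun_cong node_lin_cong shuffle_cong refl) auto
  also have "\<dots> = node_lin ?Y ?Ks (\<lambda>K. multilinear (?J K)
      (\<lambda>T. shuffle q (?M K, K) (\<lambda>a. if a \<in> ?J K then T a else E a)) F)"
    unfolding node_lin_def using finite_components[OF HY] finJ disj
    by (intro multilinear_multilinear[symmetric]) auto
  also have "\<dots> = node_lin ?Y ?Ks (\<lambda>K. shuffle q ({a \<in> M. \<Union>a \<subseteq> \<Union>K}, K) E)"
    using shuffle_K by (intro node_lin_cong refl) simp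
  finally show ?thesis .
qed

section \<open>The two cases of the polydendriform equation\<close>

lemma shuffle_part_team:
  assumes "(A, H) \<in> \<Xi>" "\<And>a. a \<in> A \<Longrightarrow> is_construct a (C a)" "B \<noteq> {}" "B \<subseteq> A"
  shows "shuffle_part q (A, H) B C =
    node_lin (\<Union>b\<in>B. root_label (C b)) (components (delete H (\<Union>b\<in>B. root_label (C b))))
      (\<lambda>K. shuffle q ({a \<in> split_members A B (\<lambda>b. root_label (C b)). \<Union>a \<subseteq> \<Union>K}, K)
        (split_constructs A B C))"
  using team_delegation[OF assms(1,2)] assms(3,4)
  by (subst shuffle_part.simps) (simp only: subteam_def simp_thms if_True)

lemma graft_disjoint:
  assumes "(A, H) \<in> \<Xi>" "a0 \<in> A" "(A', a0) \<in> \<Xi>" "\<Union>a0 \<noteq> {}"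
  shows "(A - {a0}) \<inter> A' = {}"
proof -
  have "\<Union>H \<noteq> {}" using team_member_subset[OF assms(1,2)] assms(4) by auto
  then have "L \<notin> A'" if "L \<in> A - {a0}" for L
    using that assms(2,3) by (intro multi_graft_notin[OF assms(1), of L a0]) auto
  then show ?thesis by (simp add: disjoint_iff)
qed

lemma roots_choice:
  assumes "B \<noteq> {}" "B \<subseteq> A" "\<And>b. b \<in> B \<Longrightarrow> is_construct b (C b)"
  shows "choice A B (\<lambda>b. root_label (C b))"
  unfolding choice_def using assms(1,2) construct_root(1,2)[OF assms(3)] by simp

text \<open>\<open>a0\<close> is not split, so it survives as a member over exactly one component,
  and \<open>A'\<close> is grafted there unchanged.\<close>

lemma shuffle_part_graft_outside:
  assumes single: "\<And>K. card (\<Union>K) < card (\<Union>H) \<Longrightarrow> shuffle_assoc_at q K"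
    and A: "(A, H) \<in> \<Xi>" "a0 \<in> A" "(A', a0) \<in> \<Xi>" "\<Union>a0 \<noteq> {}"
    and C: "\<And>a. a \<in> graft A a0 A' \<Longrightarrow> is_construct a (C a)"
    and B: "B \<noteq> {}" "B \<subseteq> A - {a0}"
  shows "shuffle_part q (graft A a0 A', H) B C =
    shuffle_part_lin q (A, H) B (put_at C a0 (shuffle q (A', a0) C))"
proof -
  let ?A = "graft A a0 A'"
  let ?X = "\<lambda>b. root_label (C b)"
  let ?E = "split_constructs ?A B C"
  have team: "(?A, H) \<in> \<Xi>" by (rule graft_team[OF A(1-3)])
  have del: "delegation (?A, H) C" by (rule team_delegation[OF team C])
  have disj: "(A - {a0}) \<inter> A' = {}" by (rule graft_disjoint[OF A])
  have BA: "B \<subseteq> A" "B \<subseteq> ?A" "a0 \<in> A - B" "A' \<subseteq> ?A - B"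
    using B A(2) disj by (auto simp: graft_def)
  have CB: "is_construct b (C b)" if "b \<in> B" for b using C BA(2) that by auto
  \<comment> \<open>A component of \<open>b\<close> is nonempty and disjoint from \<open>a0\<close>.
    Hence \<open>a0\<close> occurs among the split members only as a retained one.\<close>
  have a0_notin: "a0 \<notin> components (delete b (?X b))" if "b \<in> B" for b
  proof
    have b: "b \<in> A" "b \<notin> {a0}" using that B(2) by auto
    assume "a0 \<in> components (delete b (?X b))"
    then have "a0 \<notin> {a0}"
      using A(2) by (intro component_of_member_notin[OF teamD(4)[OF A(1)] b _ teamD(3)[OF A(1) b(1)]]) auto
    then show False by simp
  qed
  have M: "split_members ?A B ?X = (split_members A B ?X - {a0}) \<union> (\<Union>L\<in>{a0}. A')"
    unfolding split_members_def using a0_notin BA(3,4) by (auto simp: graft_def)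
  have FE: "shuffle q (A', a0) C = shuffle q (A', a0) ?E"
    using BA(4) by (intro shuffle_cong split_constructs_keep[symmetric]) auto
  have "shuffle_part q (?A, H) B C =
      node_lin (\<Union>b\<in>B. ?X b) (components (delete H (\<Union>b\<in>B. ?X b)))
      (\<lambda>K. shuffle q ({a \<in> split_members ?A B ?X. \<Union>a \<subseteq> \<Union>K}, K) ?E)"
    by (rule shuffle_part_team[OF team C B(1) BA(2)])
  also have "\<dots> = shuffle_part_lin q (A, H) B (put_at C a0
      (multilinear {a0} (\<lambda>T. Poly_Mapping.single (T a0) 1) (\<lambda>_. shuffle q (A', a0) C)))"
  proof (rule shuffle_part_lin_graft[symmetric, OF single A(1,2) _ _ _ _ _ _ _ _ _ M])
    show "choice A B ?X" by (rule roots_choice[OF B(1) BA(1) CB])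
    show "is_construct a (C a)" if "a \<in> A - {a0}" for a using C that by (auto simp: graft_def)
    show "is_construct a (?E a)" if "a \<in> split_members ?A B ?X" for a
      by (rule split_constructs_construct[OF del BA(2) that])
    show "{a0} \<subseteq> split_members A B ?X" using BA(3) by (simp add: split_members_def)
    show "(A', L) \<in> \<Xi>" "shuffle q (A', a0) C = shuffle q (A', L) ?E" if "L \<in> {a0}" for L
      using that A(3) FE by auto
    fix T assume "T \<in> (\<Pi>\<^sub>E L\<in>{a0}. keys (shuffle q (A', a0) C))"
    then have "T a0 \<in> keys (shuffle q (A', a0) C)" by auto
    then show T: "is_construct a0 (T a0)" using keys_shuffle_construct(1) by fastforce
    show "a0 \<in> B \<Longrightarrow> root_label (T a0) = ?X a0" using BA(3) by simp
    have del': "delegation (A, H) (C(a0 := T a0))"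
      using T C by (intro team_delegation[OF A(1)]) (auto simp: graft_def)
    fix a assume a: "a \<in> split_members A B ?X"
    show "split_constructs A B (C(a0 := T a0)) a = (if a \<in> {a0} then T a else ?E a)"
    proof (cases "a \<in> A - B")
      case True
      then show ?thesis
        using split_constructs_keep[of a A B] split_constructs_keep[of a ?A B C]
        by (auto simp: graft_def)
    next
      case False
      then obtain b where b: "b \<in> B" "a \<in> components (delete b (?X b))"
        using a by (auto simp: split_members_def)
      then have "b \<noteq> a0" "a \<noteq> a0" using BA(3) a0_notin[OF b(1)] by auto
      then show ?thesis
        using split_constructs_eq[OF del' BA(1) b(1) del BA(2) b(1)] b(2) by simp
    qed
  qed auto
  also have "\<dots> = shuffle_part_lin q (A, H) B (put_at C a0 (shuffle q (A', a0) C))"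
    by (simp only: multilinear_singleton)
  finally show ?thesis .
qed

text \<open>Every tree in the \<open>B'\<close>-part over \<open>a0\<close> has the same root label,
  the union of the roots chosen in \<open>A'\<close>. Splitting \<open>a0\<close> at such a tree
  therefore deletes the same vertices as splitting \<open>A'\<close> at \<open>B'\<close>, and the
  pieces of \<open>A'\<close> form teams over the components that \<open>a0\<close> leaves.\<close>

lemma shuffle_part_graft_inside:
  assumes single: "\<And>K. card (\<Union>K) < card (\<Union>H) \<Longrightarrow> shuffle_assoc_at q K"
    and A: "(A, H) \<in> \<Xi>" "a0 \<in> A" "(A', a0) \<in> \<Xi>" "\<Union>a0 \<noteq> {}"
    and C: "\<And>a. a \<in> graft A a0 A' \<Longrightarrow> is_construct a (C a)"
    and B: "B \<subseteq> A - {a0}" "B' \<noteq> {}" "B' \<subseteq> A'"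
  shows "shuffle_part q (graft A a0 A', H) (B \<union> B') C =
    shuffle_part_lin q (A, H) (insert a0 B) (put_at C a0 (shuffle_part q (A', a0) B' C))"
proof -
  let ?A = "graft A a0 A'" and ?B = "B \<union> B'"
  let ?R = "\<lambda>b. root_label (C b)"
  let ?E = "split_constructs ?A ?B C"
  \<comment> \<open>\<open>Y'\<close> is the common root over \<open>a0\<close>, \<open>Ls\<close>
    are the components it leaves, \<open>N L\<close> is the subteam of \<open>A'\<close> over
    \<open>L\<close>, and \<open>Q\<close> collects the split members not coming from
    \<open>a0\<close>.\<close>
  define Y' where "Y' = (\<Union>b\<in>B'. ?R b)"
  define X where "X = ?R(a0 := Y')"
  define Ls where "Ls = components (delete a0 Y')"
  define N where "N L = {a \<in> split_members A' B' ?R. \<Union>a \<subseteq> \<Union>L}" for L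
  define F where "F L = shuffle q (N L, L) (split_constructs A' B' C)" for L
  define g where "g T = Node Y' (Abs_fset (T ` Ls))" for T
  define Q where "Q = (A - insert a0 B) \<union> (\<Union>b\<in>B. components (delete b (?R b)))"
  have team: "(?A, H) \<in> \<Xi>" by (rule graft_team[OF A(1-3)])
  have del: "delegation (?A, H) C" by (rule team_delegation[OF team C])
  have C': "is_construct a (C a)" if "a \<in> A'" for a using C that by (auto simp: graft_def)
  have del': "delegation (A', a0) C" by (rule team_delegation[OF A(3) C'])
  have disj: "(A - {a0}) \<inter> A' = {}" by (rule graft_disjoint[OF A])
  have BA: "insert a0 B \<subseteq> A" "?B \<subseteq> ?A" "a0 \<notin> B" "A' - B' \<subseteq> ?A - ?B"
    "A - insert a0 B \<subseteq> ?A - ?B"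
    using B A(2) disj by (auto simp: graft_def)
  have CB: "is_construct b (C b)" if "b \<in> B" for b using C BA(2) that by auto
  have a0_hyp: "hypergraph a0" by (rule teamD(1)[OF A(3)])
  have ch': "choice A' B' ?R" using B C' by (intro roots_choice) auto
  have Y': "Y' \<noteq> {}" "Y' \<subseteq> \<Union>a0"
  proof -
    obtain b where "b \<in> B'" using B(2) by auto
    moreover from this have "?R b \<noteq> {}" using B(3) construct_root(1)[OF C'] by auto
    ultimately show "Y' \<noteq> {}" unfolding Y'_def by blast
    have "?R b \<subseteq> \<Union>a0" if "b \<in> B'" for b
      using construct_root(2)[OF C'] team_member_subset[OF A(3)] B(3) that by (meson order_trans subsetD)
    then show "Y' \<subseteq> \<Union>a0" unfolding Y'_def by (rule UN_least)
  qed
  have Xa0: "X a0 = Y'" by (simp add: X_def)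
  have Xb: "X b = ?R b" if "b \<in> B" for b using that BA(3) by (auto simp: X_def)
  have ch: "choice A (insert a0 B) X"
    unfolding choice_def
  proof (intro conjI ballI BA(1))
    fix b assume b: "b \<in> insert a0 B"
    show "X b \<noteq> {}" "X b \<subseteq> \<Union>b"
      using b Y' construct_root(1,2)[OF CB] Xb by (cases "b = a0"; simp add: X_def)+
  qed simp
  have Un_X: "(\<Union>b\<in>insert a0 B. X b) = (\<Union>b\<in>?B. ?R b)"
  proof -
    have "(\<Union>b\<in>insert a0 B. X b) = Y' \<union> (\<Union>b\<in>B. ?R b)" using Xb Xa0 by simp
    then show ?thesis by (simp only: Y'_def UN_Un Un_commute)
  qed
  have split_A: "split_members A (insert a0 B) X = Q \<union> Ls"
  proof -
    have "(\<Union>b\<in>B. components (delete b (X b))) = (\<Union>b\<in>B. components (delete b (?R b)))"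
      using Xb by simp
    then show ?thesis by (simp add: split_members_def Q_def Ls_def Xa0 Un_ac)
  qed
  have split_graft: "split_members ?A ?B ?R = Q \<union> split_members A' B' ?R"
    unfolding split_members_def Q_def using B disj by (auto simp: graft_def)
  \<comment> \<open>A common element would have a nonempty carrier inside both \<open>a0\<close> and
    another member. Disjointness ensures that discarding \<open>Ls\<close> in \<open>M\<close> keeps
    all of \<open>Q\<close>.\<close>
  have Q_Ls: "Q \<inter> Ls = {}"
  proof (rule equals0I)
    fix L assume L: "L \<in> Q \<inter> Ls"
    then have L': "L \<in> components (delete a0 Y')" by (simp add: Ls_def)
    have "L \<notin> A - insert a0 B"
      by (rule component_of_member_notin[OF teamD(4)[OF A(1)] A(2) _ _ a0_hyp L']) auto
    then obtain b where b: "b \<in> B" "L \<in> components (delete b (?R b))"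
      using L by (auto simp: Q_def)
    have bA: "b \<in> A" "b \<noteq> a0" using b B(1) by auto
    have "\<Union>L \<subseteq> \<Union>b - ?R b" by (rule component_delete_subset[OF teamD(3)[OF A(1) bA(1)] b(2)])
    moreover have "\<Union>L \<subseteq> \<Union>a0 - Y'" by (rule component_delete_subset[OF a0_hyp L'])
    moreover have "\<Union>L \<noteq> {}" by (rule component_hypergraph(2)[OF hypergraph_delete[OF a0_hyp] L'])
    ultimately have "\<Union>b \<inter> \<Union>a0 \<noteq> {}" by auto
    then show False using member_eqI[OF teamD(4)[OF A(1)] bA(1) A(2)] bA(2) by simp
  qed
  \<comment> \<open>Strictness of the team on \<open>a0\<close> enters here: each piece of
    \<open>A'\<close> lies inside some component of \<open>a0\<close> minus \<open>Y'\<close>, so no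
    piece is lost.\<close>
  have N_Un: "(\<Union>L\<in>Ls. N L) = split_members A' B' ?R"
  proof
    show "(\<Union>L\<in>Ls. N L) \<subseteq> split_members A' B' ?R" by (intro UN_least) (simp add: N_def)
    show "split_members A' B' ?R \<subseteq> (\<Union>L\<in>Ls. N L)"
    proof
      fix a assume a: "a \<in> split_members A' B' ?R"
      obtain L where "L \<in> Ls" "\<Union>a \<subseteq> \<Union>L"
        using split_in_component[OF A(3) ch' a] unfolding Ls_def Y'_def .
      then show "a \<in> (\<Union>L\<in>Ls. N L)" using a by (intro UN_I[of L]) (simp_all add: N_def)
    qed
  qed
  have M: "split_members ?A ?B ?R = (split_members A (insert a0 B) X - Ls) \<union> (\<Union>L\<in>Ls. N L)"
    unfolding split_A N_Un split_graft using Q_Ls by auto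
  have sc': "split_constructs A' B' C a = ?E a" if a: "a \<in> split_members A' B' ?R" for a
  proof (cases "a \<in> A' - B'")
    case True
    then show ?thesis by (simp only: split_constructs_keep subsetD[OF BA(4)])
  next
    case False
    then obtain b where b: "b \<in> B'" "a \<in> components (delete b (?R b))"
      using a by (auto simp: split_members_def)
    then show ?thesis by (intro split_constructs_eq[OF del' B(3) b(1) del BA(2)]) auto
  qed
  have "shuffle_part q (?A, H) ?B C =
      node_lin (\<Union>b\<in>insert a0 B. X b) (components (delete H (\<Union>b\<in>insert a0 B. X b)))
      (\<lambda>K. shuffle q ({a \<in> split_members ?A ?B ?R. \<Union>a \<subseteq> \<Union>K}, K) ?E)"
    unfolding Un_X using B(2) by (intro shuffle_part_team[OF team C _ BA(2)]) auto
  also have "\<dots> = shuffle_part_lin q (A, H) (insert a0 B) (put_at C a0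
      (multilinear Ls (\<lambda>T. Poly_Mapping.single (g T) 1) F))"
  proof (rule shuffle_part_lin_graft[symmetric, OF single A(1,2) _ ch _ _ _ _ _ _ _ M])
    show "is_construct a (C a)" if "a \<in> A - {a0}" for a using C that by (auto simp: graft_def)
    show "is_construct a (?E a)" if "a \<in> split_members ?A ?B ?R" for a
      by (rule split_constructs_construct[OF del BA(2) that])
    show "?R b = X b" if "b \<in> insert a0 B" "b \<noteq> a0" for b using that by (simp add: X_def)
    show "Ls \<subseteq> split_members A (insert a0 B) X" unfolding split_A by simp
    show "(N L, L) \<in> \<Xi>" if "L \<in> Ls" for L
      using subteam_team[OF A(3) ch'] that unfolding N_def Ls_def Y'_def by blast
    show "F L = shuffle q (N L, L) ?E" if "L \<in> Ls" for L
      unfolding F_def by (intro shuffle_cong sc') (simp add: N_def)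
    fix T assume T: "T \<in> (\<Pi>\<^sub>E L\<in>Ls. keys (F L))"
    have TL: "is_construct L (T L)" if "L \<in> Ls" for L
      using keys_shuffle_construct(1)[OF PiE_mem[OF T that, unfolded F_def]] by simp
    then show gT: "is_construct a0 (g T)"
      unfolding g_def Ls_def by (intro construct_NodeI[OF a0_hyp Y'])
    show "root_label (g T) = X a0" by (simp add: g_def X_def)
    let ?C = "C(a0 := g T)"
    have delT: "delegation (A, H) ?C"
      using gT C by (intro team_delegation[OF A(1)]) (auto simp: graft_def)
    fix a assume a: "a \<in> split_members A (insert a0 B) X"
    \<comment> \<open>At a component of \<open>a0\<close> the split returns the entry of
      \<open>T\<close> from which \<open>g T\<close> was built; elsewhere the tree at
      \<open>a0\<close> has no influence.\<close>
    show "split_constructs A (insert a0 B) ?C a = (if a \<in> Ls then T a else ?E a)"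
    proof (cases "a \<in> Ls")
      case True
      have "finite Ls" unfolding Ls_def by (intro finite_components hypergraph_delete a0_hyp)
      then have "T a |\<in>| subtrees (?C a0)" using True by (simp add: g_def Abs_fset_inverse)
      moreover have "a \<in> components (delete a0 (root_label (?C a0)))"
        using True by (simp add: g_def Ls_def)
      ultimately have "split_constructs A (insert a0 B) ?C a = T a"
        using TL[OF True] by (intro split_constructs_component[OF delT BA(1)]) auto
      then show ?thesis using True by simp
    next
      case False
      then have Q: "a \<in> Q" using a split_A by auto
      have "split_constructs A (insert a0 B) ?C a = ?E a"
      proof (cases "a \<in> A - insert a0 B")
        case True
        then have "a \<noteq> a0" "a \<in> ?A - ?B" using BA(5) by auto
        then show ?thesis using True by (simp only: split_constructs_keep fun_upd_apply if_False)
      next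
        case False
        then obtain b where b: "b \<in> B" "a \<in> components (delete b (?R b))"
          using Q by (auto simp: Q_def)
        then have "b \<noteq> a0" using BA(3) by auto
        then show ?thesis
          using b by (intro split_constructs_eq[OF delT BA(1) _ del BA(2), of b]) auto
      qed
      then show ?thesis using False by simp
    qed
  qed
  also have "multilinear Ls (\<lambda>T. Poly_Mapping.single (g T) 1) F = shuffle_part q (A', a0) B' C"
    unfolding g_def F_def[abs_def] N_def Ls_def Y'_def node_lin_def[symmetric]
    by (rule shuffle_part_team[OF A(3) C' B(2,3), symmetric])
  finally show ?thesis .
qed

lemma shuffle_assoc: "shuffle_assoc_at q H"
proof (induction "card (\<Union>H)" arbitrary: H rule: less_induct)
  case less
  show ?case
    unfolding shuffle_assoc_at_def
  proof (intro allI impI)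
    fix A a0 A' C
    assume A: "(A, H) \<in> \<Xi>" "a0 \<in> A" "(A', a0) \<in> \<Xi>"
      and C: "\<forall>a\<in>graft A a0 A'. is_construct a (C a)"
    show "shuffle q (graft A a0 A', H) C =
        linear_ext (\<lambda>t. shuffle q (A, H) (C(a0 := t))) (shuffle q (A', a0) C)"
    proof (cases "\<Union>a0 = {}")
      case True
      \<comment> \<open>An empty member forces an empty ambient carrier. An empty carrier admits no
        construct, so the grafted team is empty, and so is \<open>A'\<close>; both sides are then
        \<open>0\<close>.\<close>
      have "\<Union>H = {}" using member_nonempty[OF A(1) _ A(2)] True by auto
      then have "\<Union>a = {}" if "a \<in> graft A a0 A'" for a
        using team_member_subset[OF graft_team[OF A] that] by (simp only: subset_empty)
      then have "graft A a0 A' = {}" using construct_root(3) C by (meson equals0I)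
      moreover from this have "A' = {}" by (simp add: graft_def)
      ultimately show ?thesis by (simp add: shuffle.simps)
    next
      case False
      show ?thesis
      proof (rule shuffle_graft_of_parts)
        show "finite A" "finite A'" using teamD(2) A by auto
        show "(A - {a0}) \<inter> A' = {}" by (rule graft_disjoint[OF A False])
        have C': "is_construct a (C a)" if "a \<in> graft A a0 A'" for a using C that by (rule bspec)
        show "shuffle_part q (graft A a0 A', H) B C =
            shuffle_part_lin q (A, H) B (put_at C a0 (shuffle q (A', a0) C))"
          if "B \<noteq> {}" "B \<subseteq> A - {a0}" for B
          by (rule shuffle_part_graft_outside[OF less A False C' that])
        show "shuffle_part q (graft A a0 A', H) (B \<union> B') C =
            shuffle_part_lin q (A, H) (insert a0 B) (put_at C a0 (shuffle_part q (A', a0) B' C))"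
          if "B \<subseteq> A - {a0}" "B' \<noteq> {}" "B' \<subseteq> A'" for B B'
          by (rule shuffle_part_graft_inside[OF less A False C' that])
      qed (rule A(2))
    qed
  qed
qed

end

theorem theorem4p15:
  fixes U :: "'v hgraph set" and \<Xi> :: "'v team set" and q :: real
    and A A' A'' :: "'v hgraph set" and H a0 :: "'v hgraph" and C :: "'v hgraph \<Rightarrow> 'v ctree"
  assumes "is_universe U" and "strict_clan U \<Xi>" and "associative_clan \<Xi>"
    and "(A, H) \<in> \<Xi>" and "a0 \<in> A" and "(A', a0) \<in> \<Xi>"
    and "A'' = graft A a0 A'"
    and "\<And>a. a \<in> A'' \<Longrightarrow> is_construct a (C a)"
  shows "(\<forall>B''. B'' \<noteq> {} \<and> B'' \<subseteq> A'' \<longrightarrow>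
            (B'' \<subseteq> A - {a0} \<longrightarrow>
               shuffle_part q (A'', H) B'' C =
               shuffle_part_lin q (A, H) B'' (put_at C a0 (shuffle q (A', a0) C))) \<and>
            (\<not> B'' \<subseteq> A - {a0} \<longrightarrow>
               (let B = (B'' \<inter> (A - {a0})) \<union> {a0}; B' = {a' \<in> A'. a' \<in> B''}
                in B \<noteq> {} \<and> B' \<noteq> {} \<and>
                   shuffle_part q (A'', H) B'' C =
                   shuffle_part_lin q (A, H) B
                     (put_at C a0 (shuffle_part q (A', a0) B' C))))) \<and>
         shuffle q (A'', H) C = shuffle_lin q (A, H) (put_at C a0 (shuffle q (A', a0) C))"
proof -
  interpret assoc_clan U \<Xi> by unfold_locales fact+
  note A = assms(4-6)
  have C: "is_construct a (C a)" if "a \<in> graft A a0 A'" for a using assms(7,8) that by simp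
  \<comment> \<open>A nonempty index set provides a member carrying a construct, hence a nonempty
    \<open>H\<close>; strictness then rules out an empty \<open>a0\<close>.\<close>
  have nonempty: "\<Union>a0 \<noteq> {}" if B: "B \<noteq> {}" "B \<subseteq> graft A a0 A'" for B
  proof -
    obtain b where b: "b \<in> graft A a0 A'" using B by auto
    have "\<Union>b \<subseteq> \<Union>H" by (rule team_member_subset[OF graft_team[OF A] b])
    then have "\<Union>H \<noteq> {}" using construct_root(3)[OF C[OF b]] by auto
    then show ?thesis by (rule member_nonempty[OF A(1) _ A(2)])
  qed
  show ?thesis
    unfolding assms(7)
  proof (intro conjI allI impI)
    fix B assume B: "B \<noteq> {} \<and> B \<subseteq> graft A a0 A'" "B \<subseteq> A - {a0}"
    \<comment> \<open>The equations for the parts ask for the total equation on smaller carriers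
      only; after the induction \<open>shuffle_assoc\<close> supplies it on all.\<close>
    then show "shuffle_part q (graft A a0 A', H) B C =
        shuffle_part_lin q (A, H) B (put_at C a0 (shuffle q (A', a0) C))"
      using nonempty by (intro shuffle_part_graft_outside[OF shuffle_assoc A _ C]) auto
  next
    fix B assume B: "B \<noteq> {} \<and> B \<subseteq> graft A a0 A'" "\<not> B \<subseteq> A - {a0}"
    let ?B = "B \<inter> (A - {a0})" and ?B' = "{a' \<in> A'. a' \<in> B}"
    have B': "?B' \<noteq> {}" and eq: "?B \<union> ?B' = B" using B by (auto simp: graft_def)
    have "shuffle_part q (graft A a0 A', H) (?B \<union> ?B') C =
        shuffle_part_lin q (A, H) (insert a0 ?B) (put_at C a0 (shuffle_part q (A', a0) ?B' C))"
      using nonempty B B' by (intro shuffle_part_graft_inside[OF shuffle_assoc A _ C]) auto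
    then show "let B1 = ?B \<union> {a0}; B' = ?B' in B1 \<noteq> {} \<and> B' \<noteq> {} \<and>
        shuffle_part q (graft A a0 A', H) B C =
        shuffle_part_lin q (A, H) B1 (put_at C a0 (shuffle_part q (A', a0) B' C))"
      using B' unfolding eq Let_def by simp
  next
    show "shuffle q (graft A a0 A', H) C =
        shuffle_lin q (A, H) (put_at C a0 (shuffle q (A', a0) C))"
      using shuffle_assoc[unfolded shuffle_assoc_at_def] A C
      by (simp add: shuffle_lin_put_at[OF teamD(2)[OF A(1)] A(2)])
  qed
qed

end
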